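(* Let $G$ be a finite group, $N\trianglelefteq G$ a normal subgroup and $\theta$ an irreducible $N$-representation, with inertia group $I_G(\theta)$. Then $\mathrm{Ind}_N^G\theta$ decomposes without multiplicities if and only if the following conditions are satisfied: (i) $I_G(\theta)/N$ is Abelian; (ii) $\mathrm{Res}^{I_G(\theta)}_N\xi\sim\theta$ for all $\xi\in\widehat I(\theta)$.
   Context: Representations are complex, unitary and finite-dimensional; $\sim$ denotes equivalence. $I_G(\theta)=\{h\in G:{}^h\theta\sim\theta\}$, where ${}^h\theta(n)=\theta(h^{-1}nh)$ for $n\in N$. $\widehat I(\theta)$ is the set of (equivalence classes of) irreducible representations $\xi$ of $I_G(\theta)$ that are contained in $\mathrm{Ind}_N^{I_G(\theta)}\theta$. "Decomposes without multiplicities" means that every irreducible $G$-representation has multiplicity at most one. *)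

theory Defs
  imports Complex_Main "HOL-Algebra.Coset" "HOL-Library.Function_Algebras"
begin

text \<open>
  The underlying space of a representation is a finite-dimensional subspace \<open>rep_space\<close> of a complex
  vector space; the ambient space is the whole type \<open>'v\<close> with scalar multiplication \<open>rep_scale\<close>.
  The inner product (linear in its first argument) and the action are only relevant on \<open>rep_space\<close>.
\<close>

record ('g, 'v) rep =
  rep_space :: "'v set"
  rep_scale :: "complex \<Rightarrow> 'v \<Rightarrow> 'v"
  rep_inner :: "'v \<Rightarrow> 'v \<Rightarrow> complex"
  rep_act :: "'g \<Rightarrow> 'v \<Rightarrow> 'v"

definition fin_dim_inner_space :: "('g, 'v::ab_group_add) rep \<Rightarrow> bool" where
  "fin_dim_inner_space \<rho> \<longleftrightarrow>
     vector_space (rep_scale \<rho>) \<and>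
     (\<exists>B. finite B \<and> rep_space \<rho> = module.span (rep_scale \<rho>) B) \<and>
     (\<forall>u\<in>rep_space \<rho>. \<forall>v\<in>rep_space \<rho>. \<forall>w\<in>rep_space \<rho>.
        rep_inner \<rho> (u + v) w = rep_inner \<rho> u w + rep_inner \<rho> v w) \<and>
     (\<forall>c. \<forall>u\<in>rep_space \<rho>. \<forall>v\<in>rep_space \<rho>.
        rep_inner \<rho> (rep_scale \<rho> c u) v = c * rep_inner \<rho> u v) \<and>
     (\<forall>u\<in>rep_space \<rho>. \<forall>v\<in>rep_space \<rho>. rep_inner \<rho> v u = cnj (rep_inner \<rho> u v)) \<and>
     (\<forall>u\<in>rep_space \<rho>. u \<noteq> 0 \<longrightarrow> Re (rep_inner \<rho> u u) > 0)"

definition linear_between ::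
  "('g, 'v::ab_group_add) rep \<Rightarrow> ('g, 'w::ab_group_add) rep \<Rightarrow> ('v \<Rightarrow> 'w) \<Rightarrow> bool" where
  "linear_between \<rho> \<sigma> T \<longleftrightarrow>
     T \<in> rep_space \<rho> \<rightarrow> rep_space \<sigma> \<and>
     (\<forall>u\<in>rep_space \<rho>. \<forall>v\<in>rep_space \<rho>. T (u + v) = T u + T v) \<and>
     (\<forall>c. \<forall>v\<in>rep_space \<rho>. T (rep_scale \<rho> c v) = rep_scale \<sigma> c (T v))"

definition unitary_rep :: "('g, 'b) monoid_scheme \<Rightarrow> ('g, 'v::ab_group_add) rep \<Rightarrow> bool" where
  "unitary_rep G \<rho> \<longleftrightarrow>
     fin_dim_inner_space \<rho> \<and>
     (\<forall>g\<in>carrier G. linear_between \<rho> \<rho> (rep_act \<rho> g)) \<and>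
     (\<forall>v\<in>rep_space \<rho>. rep_act \<rho> \<one>\<^bsub>G\<^esub> v = v) \<and>
     (\<forall>g\<in>carrier G. \<forall>h\<in>carrier G. \<forall>v\<in>rep_space \<rho>.
        rep_act \<rho> (g \<otimes>\<^bsub>G\<^esub> h) v = rep_act \<rho> g (rep_act \<rho> h v)) \<and>
     (\<forall>g\<in>carrier G. \<forall>u\<in>rep_space \<rho>. \<forall>v\<in>rep_space \<rho>.
        rep_inner \<rho> (rep_act \<rho> g u) (rep_act \<rho> g v) = rep_inner \<rho> u v)"

definition equiv_rep ::
  "('g, 'b) monoid_scheme \<Rightarrow> ('g, 'v::ab_group_add) rep \<Rightarrow> ('g, 'w::ab_group_add) rep \<Rightarrow> bool" where
  "equiv_rep G \<rho> \<sigma> \<longleftrightarrow>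
     (\<exists>T. linear_between \<rho> \<sigma> T \<and> bij_betw T (rep_space \<rho>) (rep_space \<sigma>) \<and>
          (\<forall>g\<in>carrier G. \<forall>v\<in>rep_space \<rho>. T (rep_act \<rho> g v) = rep_act \<sigma> g (T v)))"

definition invariant_subspace ::
  "('g, 'b) monoid_scheme \<Rightarrow> ('g, 'v::ab_group_add) rep \<Rightarrow> 'v set \<Rightarrow> bool" where
  "invariant_subspace G \<rho> W \<longleftrightarrow>
     W \<subseteq> rep_space \<rho> \<and> module.subspace (rep_scale \<rho>) W \<and>
     (\<forall>g\<in>carrier G. \<forall>w\<in>W. rep_act \<rho> g w \<in> W)"

definition subrep :: "('g, 'v) rep \<Rightarrow> 'v set \<Rightarrow> ('g, 'v) rep" where
  "subrep \<rho> W = \<rho>\<lparr>rep_space := W\<rparr>"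

definition irreducible_rep ::
  "('g, 'b) monoid_scheme \<Rightarrow> ('g, 'v::ab_group_add) rep \<Rightarrow> bool" where
  "irreducible_rep G \<rho> \<longleftrightarrow>
     unitary_rep G \<rho> \<and> rep_space \<rho> \<noteq> {0} \<and>
     (\<forall>W. invariant_subspace G \<rho> W \<longrightarrow> W = {0} \<or> W = rep_space \<rho>)"

definition contained_in ::
  "('g, 'b) monoid_scheme \<Rightarrow> ('g, 'v::ab_group_add) rep \<Rightarrow> ('g, 'w::ab_group_add) rep \<Rightarrow> bool" where
  "contained_in G \<sigma> \<rho> \<longleftrightarrow>
     (\<exists>W. invariant_subspace G \<rho> W \<and> equiv_rep G \<sigma> (subrep \<rho> W))"

definition irreducible_decomposition ::
  "('g, 'b) monoid_scheme \<Rightarrow> ('g, 'v::ab_group_add) rep \<Rightarrow> 'v set set \<Rightarrow> bool" where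
  "irreducible_decomposition G \<rho> D \<longleftrightarrow>
     finite D \<and>
     (\<forall>W\<in>D. invariant_subspace G \<rho> W \<and> irreducible_rep G (subrep \<rho> W)) \<and>
     (\<forall>W\<in>D. \<forall>W'\<in>D. W \<noteq> W' \<longrightarrow> (\<forall>u\<in>W. \<forall>v\<in>W'. rep_inner \<rho> u v = 0)) \<and>
     rep_space \<rho> = module.span (rep_scale \<rho>) (\<Union>D)"

text \<open>
  A unitary representation of a finite group has an orthogonal decomposition into irreducibles, and
  the number of summands equivalent to a given irreducible does not depend on it, so the choice below
  is immaterial.
\<close>

definition multiplicity ::
  "('g, 'b) monoid_scheme \<Rightarrow> ('g, 'v::ab_group_add) rep \<Rightarrow> ('g, 'w::ab_group_add) rep \<Rightarrow> nat" where
  "multiplicity G \<sigma> \<rho> =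
     card {W \<in> (SOME D. irreducible_decomposition G \<rho> D). equiv_rep G \<sigma> (subrep \<rho> W)}"

text \<open>
  Every finite-dimensional complex inner product space is isomorphic to a subspace of
  \<open>nat \<Rightarrow> complex\<close>, so quantifying over representations on such subspaces
  covers all representations up to equivalence.
\<close>

type_synonym 'g std_rep = "('g, nat \<Rightarrow> complex) rep"

definition multiplicity_free ::
  "('g, 'b) monoid_scheme \<Rightarrow> ('g, 'v::ab_group_add) rep \<Rightarrow> bool" where
  "multiplicity_free G \<rho> \<longleftrightarrow>
     (\<forall>\<sigma> :: 'g std_rep. irreducible_rep G \<sigma> \<longrightarrow> multiplicity G \<sigma> \<rho> \<le> 1)"

definition res_rep :: "'g set \<Rightarrow> ('g, 'v) rep \<Rightarrow> ('g, 'v) rep" where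
  "res_rep H \<rho> = \<rho>\<lparr>rep_act := restrict (rep_act \<rho>) H\<rparr>"

text \<open>
  The induced representation acts by left translation on the functions \<open>f : G \<rightarrow> V\<close> with
  \<open>f (g h) = \<theta> (h\<inverse>) (f g)\<close> for \<open>h \<in> H\<close>, extended by \<open>0\<close> outside the carrier of \<open>G\<close>.
\<close>

definition induced_rep ::
  "('g, 'b) monoid_scheme \<Rightarrow> 'g set \<Rightarrow> ('g, 'v::ab_group_add) rep \<Rightarrow> ('g, 'g \<Rightarrow> 'v) rep" where
  "induced_rep G H \<theta> =
     \<lparr> rep_space = {f. (\<forall>g\<in>carrier G. f g \<in> rep_space \<theta>) \<and> (\<forall>g. g \<notin> carrier G \<longrightarrow> f g = 0) \<and>
                       (\<forall>g\<in>carrier G. \<forall>h\<in>H. f (g \<otimes>\<^bsub>G\<^esub> h) = rep_act \<theta> (inv\<^bsub>G\<^esub> h) (f g))},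
       rep_scale = (\<lambda>c f x. rep_scale \<theta> c (f x)),
       rep_inner = (\<lambda>f f'. (\<Sum>g\<in>carrier G. rep_inner \<theta> (f g) (f' g)) / of_nat (card H)),
       rep_act = (\<lambda>g f x. if x \<in> carrier G then f (inv\<^bsub>G\<^esub> g \<otimes>\<^bsub>G\<^esub> x) else 0) \<rparr>"

definition conj_rep :: "('g, 'b) monoid_scheme \<Rightarrow> 'g \<Rightarrow> ('g, 'v) rep \<Rightarrow> ('g, 'v) rep" where
  "conj_rep G h \<theta> = \<theta>\<lparr>rep_act := \<lambda>n. rep_act \<theta> (inv\<^bsub>G\<^esub> h \<otimes>\<^bsub>G\<^esub> n \<otimes>\<^bsub>G\<^esub> h)\<rparr>"

definition inertia_group ::
  "('g, 'b) monoid_scheme \<Rightarrow> 'g set \<Rightarrow> ('g, 'v::ab_group_add) rep \<Rightarrow> 'g set" where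
  "inertia_group G N \<theta> = {h \<in> carrier G. equiv_rep (G\<lparr>carrier := N\<rparr>) (conj_rep G h \<theta>) \<theta>}"

definition I_hat ::
  "('g, 'b) monoid_scheme \<Rightarrow> 'g set \<Rightarrow> ('g, 'v::ab_group_add) rep \<Rightarrow> 'g std_rep set" where
  "I_hat G N \<theta> =
     {\<xi>. irreducible_rep (G\<lparr>carrier := inertia_group G N \<theta>\<rparr>) \<xi> \<and>
         contained_in (G\<lparr>carrier := inertia_group G N \<theta>\<rparr>) \<xi>
           (induced_rep (G\<lparr>carrier := inertia_group G N \<theta>\<rparr>) N \<theta>)}"

end

theory Submission
  imports Defs "HOL-Computational_Algebra.Fundamental_Theorem_Algebra"
begin

text \<open>
  A unitary representation is multiplicity free iff its endomorphisms commute. The endomorphisms of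
  \<open>Ind\<^sub>N\<^sup>G \<theta>\<close> are convolution operators whose kernels live on the inertia group \<open>I\<close>: they are spanned by
  \<open>(L\<^sub>x f)(g) = T\<^sub>x (f (g x))\<close> for \<open>x \<in> I\<close>, where \<open>T\<^sub>x\<close> is the intertwiner from the \<open>x\<close>-conjugate of \<open>\<theta>\<close> to \<open>\<theta>\<close>,
  unique up to scalars.

  If the induced representation is multiplicity free, the \<open>L\<^sub>x\<close> commute; evaluating on a function supported on \<open>N\<close> shows that \<open>I/N\<close> is
  Abelian. Moreover each \<open>L\<^sub>x\<close> is a scalar on each irreducible summand \<open>U\<close>, so that the restriction of
  \<open>f \<in> U\<close> to \<open>I\<close> is determined by \<open>f(1)\<close>; composing an embedding of \<open>\<xi>\<close> with the projection to a suitable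
  \<open>U\<close> and evaluation at \<open>1\<close> then gives the equivalence of \<open>\<xi>\<close>, restricted to \<open>N\<close>, with \<open>\<theta>\<close>. Conversely an extension
  \<open>\<xi>\<close> of \<open>\<theta>\<close> to \<open>I\<close> permits the choice \<open>T\<^sub>x = \<xi>(x)\<close>, and then \<open>L\<^sub>x L\<^sub>y = L\<^sub>x\<^sub>y\<close> depends only on the coset of
  \<open>x y\<close>, so that the \<open>L\<^sub>x\<close> commute when \<open>I/N\<close> is Abelian.
\<close>

section \<open>Finite-dimensional inner product spaces\<close>

locale fd_inner =
  fixes \<rho> :: "('g, 'v::ab_group_add) rep"
  assumes fd: "fin_dim_inner_space \<rho>"
begin

abbreviation "V \<equiv> rep_space \<rho>"
abbreviation "ip \<equiv> rep_inner \<rho>"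

sublocale vector_space "rep_scale \<rho>"
  using fd unfolding fin_dim_inner_space_def by blast

lemma finite_span_V: "\<exists>B. finite B \<and> V = span B"
  using fd unfolding fin_dim_inner_space_def by blast

lemma subspace_V: "subspace V"
  using finite_span_V by auto

lemma ip_add_left: "u \<in> V \<Longrightarrow> v \<in> V \<Longrightarrow> w \<in> V \<Longrightarrow> ip (u + v) w = ip u w + ip v w"
  using fd unfolding fin_dim_inner_space_def by blast

lemma ip_scale_left: "u \<in> V \<Longrightarrow> v \<in> V \<Longrightarrow> ip (rep_scale \<rho> c u) v = c * ip u v"
  using fd unfolding fin_dim_inner_space_def by blast

lemma ip_cnj: "u \<in> V \<Longrightarrow> v \<in> V \<Longrightarrow> ip v u = cnj (ip u v)"
  using fd unfolding fin_dim_inner_space_def by blast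

lemma ip_pos: "u \<in> V \<Longrightarrow> u \<noteq> 0 \<Longrightarrow> 0 < Re (ip u u)"
  using fd unfolding fin_dim_inner_space_def by blast

lemma ip_self_eq_0: "u \<in> V \<Longrightarrow> ip u u = 0 \<Longrightarrow> u = 0"
  using ip_pos by fastforce

lemma ip_add_right: "u \<in> V \<Longrightarrow> v \<in> V \<Longrightarrow> w \<in> V \<Longrightarrow> ip w (u + v) = ip w u + ip w v"
  using ip_cnj[of "u + v" w] ip_cnj[of u w] ip_cnj[of v w]
  by (simp add: subspace_add[OF subspace_V] ip_add_left)

lemma ip_scale_right: "u \<in> V \<Longrightarrow> v \<in> V \<Longrightarrow> ip v (rep_scale \<rho> c u) = cnj c * ip v u"
  using ip_cnj[of "rep_scale \<rho> c u" v] ip_cnj[of u v]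
  by (simp add: subspace_scale[OF subspace_V] ip_scale_left)

lemma ip_zero_left [simp]: "u \<in> V \<Longrightarrow> ip 0 u = 0"
  using ip_scale_left[of 0 u 0] subspace_0[OF subspace_V] by simp

lemma ip_zero_right [simp]: "u \<in> V \<Longrightarrow> ip u 0 = 0"
  using ip_cnj[of 0 u] subspace_0[OF subspace_V] by simp

lemma ip_diff_left: "u \<in> V \<Longrightarrow> v \<in> V \<Longrightarrow> w \<in> V \<Longrightarrow> ip (u - v) w = ip u w - ip v w"
  using ip_add_left[of "u - v" v w] subspace_diff[OF subspace_V, of u v] by simp

lemma ip_eq_0_sym: "u \<in> V \<Longrightarrow> v \<in> V \<Longrightarrow> ip u v = 0 \<Longrightarrow> ip v u = 0"
  by (simp add: ip_cnj[of u v])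

lemma ip_sum_left:
  "(\<And>i. i \<in> I \<Longrightarrow> f i \<in> V) \<Longrightarrow> v \<in> V \<Longrightarrow> ip (sum f I) v = (\<Sum>i\<in>I. ip (f i) v)"
proof (induction I rule: infinite_finite_induct)
  case (insert x F)
  then have "sum f F \<in> V" by (intro subspace_sum[OF subspace_V]) auto
  then show ?case using insert by (simp add: ip_add_left)
qed simp_all

section \<open>Bases, orthogonality and orthogonal projections\<close>

lemma orthogonal_span:
  assumes "v \<in> V" "B \<subseteq> V" "\<And>b. b \<in> B \<Longrightarrow> ip v b = 0" "w \<in> span B"
  shows "ip v w = 0"
proof -
  have "subspace {w \<in> V. ip v w = 0}"
    using assms(1) subspace_V
    by (auto intro!: subspaceI simp: subspace_0 subspace_add subspace_scale ip_add_right ip_scale_right)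
  then have "span B \<subseteq> {w \<in> V. ip v w = 0}"
    using assms by (intro span_minimal) auto
  then show ?thesis using assms(4) by auto
qed

lemma subspace_basis:
  assumes "subspace W" "W \<subseteq> V"
  shows "\<exists>B. finite B \<and> independent B \<and> B \<subseteq> W \<and> span B = W \<and> card B = dim W"
proof -
  obtain B where B: "B \<subseteq> W" "independent B" "W \<subseteq> span B" "card B = dim W"
    using basis_exists by blast
  obtain A where "finite A" "V = span A" using finite_span_V by blast
  then have "finite B" using independent_span_bound[of A B] B assms by blast
  moreover have "span B = W" using B assms span_minimal by blast
  ultimately show ?thesis using B by blast
qed

lemma dim_strict_mono:
  assumes "subspace U" "subspace W" "U \<subset> W" "W \<subseteq> V"
  shows "dim U < dim W"
proof -
  obtain B where B: "finite B" "independent B" "B \<subseteq> U" "span B = U" "card B = dim U"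
    using subspace_basis[of U] assms by auto
  obtain C where C: "finite C" "span C = W" "card C = dim W"
    using subspace_basis[of W] assms by auto
  obtain w where w: "w \<in> W" "w \<notin> U" using assms by blast
  have "independent (insert w B)" using B w independent_insertI by auto
  moreover have "insert w B \<subseteq> span C" using B C w assms by auto
  ultimately have "card (insert w B) \<le> card C" using independent_span_bound C by blast
  moreover have "w \<notin> B" using B w span_base by blast
  ultimately show ?thesis using B C by simp
qed

text \<open>One Gram-Schmidt step per generator: first project both \<open>v\<close> and the new
  generator \<open>b\<close> to the span of the old ones, then correct along the residual
  \<open>b - wb\<close>. If this residual vanishes, \<open>a\<close> is 0 by the convention on
  division, and \<open>b\<close> already lies in the old span.\<close>

lemma projection_span_exists:
  assumes "finite B" "B \<subseteq> V" "v \<in> V"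
  shows "\<exists>w \<in> span B. \<forall>b \<in> B. ip (v - w) b = 0"
  using assms
proof (induction B arbitrary: v rule: finite_induct)
  case empty
  then show ?case by simp
next
  case (insert b B)
  have spB: "span B \<subseteq> V" using insert subspace_V span_minimal by auto
  have spi: "span B \<subseteq> span (insert b B)" by (rule span_mono) auto
  obtain wb where wb: "wb \<in> span B" "\<forall>c\<in>B. ip (b - wb) c = 0" using insert by blast
  obtain wv where wv: "wv \<in> span B" "\<forall>c\<in>B. ip (v - wv) c = 0" using insert by blast
  have V: "b \<in> V" "wb \<in> V" "wv \<in> V" "v \<in> V" "b - wb \<in> V" "v - wv \<in> V"
    using wb wv spB insert subspace_diff[OF subspace_V] by auto
  define a where "a = ip (v - wv) (b - wb) / ip (b - wb) (b - wb)"
  define w where "w = wv + rep_scale \<rho> a (b - wb)"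
  have e: "v - w = (v - wv) - rep_scale \<rho> a (b - wb)" by (simp add: w_def)
  have sV: "rep_scale \<rho> a (b - wb) \<in> V" using V subspace_scale[OF subspace_V] by blast
  then have vwV: "v - w \<in> V" unfolding e using V subspace_diff[OF subspace_V] by blast
  have B0: "\<forall>c\<in>B. ip (v - w) c = 0"
    unfolding e using V wb wv insert sV by (auto simp: ip_diff_left ip_scale_left subset_iff)
  have "ip (v - w) (b - wb) = 0"
  proof (cases "b - wb = 0")
    case False
    then have "ip (b - wb) (b - wb) \<noteq> 0" using ip_self_eq_0 V by blast
    then show ?thesis unfolding e using V sV by (simp add: ip_diff_left ip_scale_left a_def)
  qed (use vwV in simp)
  moreover have "ip (v - w) wb = 0"
    using orthogonal_span[of "v - w" B wb] vwV B0 insert.prems wb by auto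
  moreover have "ip (v - w) b = ip (v - w) (b - wb) + ip (v - w) wb"
    using ip_add_right[of "b - wb" wb "v - w"] V vwV by simp
  ultimately have "ip (v - w) b = 0" by simp
  moreover have "w \<in> span (insert b B)"
    unfolding w_def using wb wv spi by (intro span_add span_scale span_diff) (auto intro: span_base)
  ultimately show ?case using B0 by blast
qed

lemma projection_exists:
  assumes "subspace W" "W \<subseteq> V" "v \<in> V"
  shows "\<exists>w \<in> W. \<forall>u \<in> W. ip (v - w) u = 0"
proof -
  obtain B where B: "finite B" "B \<subseteq> W" "span B = W" using subspace_basis assms by meson
  obtain w where w: "w \<in> W" "\<forall>b\<in>B. ip (v - w) b = 0"
    using projection_span_exists[of B v] B assms by blast
  have "v - w \<in> V" using w assms subspace_diff[OF subspace_V] by blast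
  then show ?thesis using orthogonal_span[of "v - w" B] B assms w by blast
qed

text \<open>The choice is determined by the orthogonality condition (\<open>proj_eqI\<close>)
  whenever \<open>W\<close> is a subspace of \<open>V\<close> and \<open>v\<close> lies in
  \<open>V\<close>; nothing is claimed otherwise.\<close>

definition proj :: "'v set \<Rightarrow> 'v \<Rightarrow> 'v" where
  "proj W v = (SOME w. w \<in> W \<and> (\<forall>u\<in>W. ip (v - w) u = 0))"

lemma proj:
  assumes "subspace W" "W \<subseteq> V" "v \<in> V"
  shows proj_in: "proj W v \<in> W" and proj_orth: "u \<in> W \<Longrightarrow> ip (v - proj W v) u = 0"
proof -
  have "proj W v \<in> W \<and> (\<forall>u\<in>W. ip (v - proj W v) u = 0)"
    unfolding proj_def by (rule someI_ex) (use projection_exists[OF assms] in blast)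
  then show "proj W v \<in> W" "u \<in> W \<Longrightarrow> ip (v - proj W v) u = 0" by blast+
qed

text \<open>The difference of two candidates lies in \<open>W\<close> and is orthogonal to
  \<open>W\<close>, hence to itself. Linearity and equivariance of projections later reduce to
  checking this criterion.\<close>

lemma proj_eqI:
  assumes "subspace W" "W \<subseteq> V" "v \<in> V" "w \<in> W" "\<And>u. u \<in> W \<Longrightarrow> ip (v - w) u = 0"
  shows "proj W v = w"
proof -
  let ?d = "proj W v - w"
  note p = proj[OF assms(1-3)]
  have dW: "?d \<in> W" using p assms subspace_diff by blast
  have V: "v - w \<in> V" "v - proj W v \<in> V" "?d \<in> V"
    using dW p assms subspace_diff[OF subspace_V] by blast+
  have "ip ?d ?d = ip ((v - w) - (v - proj W v)) ?d" by simp
  also have "\<dots> = ip (v - w) ?d - ip (v - proj W v) ?d" using V by (rule ip_diff_left)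
  also have "\<dots> = 0" using p(2)[OF dW] assms(5)[OF dW] by simp
  finally show ?thesis using ip_self_eq_0 V by fastforce
qed

lemma subspace_orthogonal:
  assumes "subspace W" "W \<subseteq> V" "U \<subseteq> V"
  shows "subspace {w \<in> W. \<forall>u\<in>U. ip w u = 0}"
  using assms by (auto intro!: subspaceI simp: subspace_0 subspace_add subspace_scale subset_iff
    ip_add_left ip_scale_left)

section \<open>Existence of eigenvectors\<close>

text \<open>Here \<open>p(A) v = 0\<close>. Split off a root \<open>z\<close>,
  \<open>p = (X - z) q\<close>, and put \<open>w = q(A) v\<close>, so that
  \<open>(A - z) w = 0\<close>. Either \<open>w\<close> is an eigenvector, or \<open>q\<close> is an
  annihilator of smaller degree and the induction continues. The bound \<open>n\<close> is kept
  apart from the degree so that sums have a fixed range.\<close>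

lemma eigenvector_of_annihilator:
  assumes AV: "\<And>v. v \<in> V \<Longrightarrow> A v \<in> V"
    and Aadd: "\<And>u v. u \<in> V \<Longrightarrow> v \<in> V \<Longrightarrow> A (u + v) = A u + A v"
    and Asc: "\<And>c v. v \<in> V \<Longrightarrow> A (rep_scale \<rho> c v) = rep_scale \<rho> c (A v)"
    and v: "v \<in> V" "v \<noteq> 0"
  shows "p \<noteq> 0 \<Longrightarrow> degree p < n \<Longrightarrow> (\<Sum>i<n. rep_scale \<rho> (coeff p i) ((A ^^ i) v)) = 0 \<Longrightarrow>
    \<exists>c w. w \<in> V \<and> w \<noteq> 0 \<and> A w = rep_scale \<rho> c w"
proof (induction n arbitrary: p)
  case 0
  then show ?case by simp
next
  case (Suc n)
  have pow: "(A ^^ i) v \<in> V" for i by (induction i) (use AV v in auto)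
  have Asum: "A (\<Sum>i<m. rep_scale \<rho> (f i) ((A ^^ i) v)) = (\<Sum>i<m. rep_scale \<rho> (f i) ((A ^^ Suc i) v))" for m f
  proof (induction m)
    case 0
    show ?case using Asc[of 0 0] subspace_0[OF subspace_V] by simp
  next
    case (Suc m)
    have "(\<Sum>i<m. rep_scale \<rho> (f i) ((A ^^ i) v)) \<in> V"
      by (intro subspace_sum[OF subspace_V] subspace_scale[OF subspace_V] pow)
    then show ?case using Suc Aadd Asc pow subspace_scale[OF subspace_V] by simp
  qed
  show ?case
  proof (cases "degree p = 0")
    case True
    then obtain a where a: "p = [:a:]" by (meson degree_eq_zeroE)
    \<comment> \<open>A nonzero constant cannot annihilate the nonzero vector
      \<open>v\<close>.\<close>
    have "(\<Sum>i<Suc n. rep_scale \<rho> (coeff p i) ((A ^^ i) v)) = rep_scale \<rho> a v"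
      unfolding sum.lessThan_Suc_shift by (simp add: a)
    then show ?thesis using Suc.prems v a by simp
  next
    case False
    then obtain z where "poly p z = 0"
      using fundamental_theorem_of_algebra[of p] by (auto simp: constant_degree)
    then obtain q where q: "p = [:-z, 1:] * q" by (auto simp: poly_eq_0_iff_dvd)
    have "q \<noteq> 0" using q Suc.prems by auto
    then have dq: "degree p = Suc (degree q)" unfolding q by (subst degree_mult_eq) auto
    define w where "w = (\<Sum>i<n. rep_scale \<rho> (coeff q i) ((A ^^ i) v))"
    have wV: "w \<in> V" unfolding w_def
      by (intro subspace_sum[OF subspace_V] subspace_scale[OF subspace_V] pow)
    \<comment> \<open>The added term has coefficient 0 because the degree of \<open>q\<close> is
      below \<open>n\<close>. Now \<open>w\<close> and \<open>A w\<close>, the latter read as the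
      polynomial \<open>X q\<close> in \<open>A\<close>, are sums over the same range as the one for
      \<open>p\<close> and can be compared term by term.\<close>
    have w': "w = (\<Sum>i<Suc n. rep_scale \<rho> (coeff q i) ((A ^^ i) v))"
      using dq Suc.prems by (simp add: w_def coeff_eq_0)
    have sh: "A w = (\<Sum>i<Suc n. rep_scale \<rho> (coeff (pCons 0 q) i) ((A ^^ i) v))"
      unfolding w_def Asum sum.lessThan_Suc_shift by simp
    have "0 = (\<Sum>i<Suc n. rep_scale \<rho> (coeff p i) ((A ^^ i) v))" using Suc.prems by simp
    also have "\<dots> = A w - rep_scale \<rho> z w"
      unfolding sh unfolding w' scale_sum_right sum_subtractf[symmetric]
      by (intro sum.cong refl) (simp add: q scale_left_diff_distrib algebra_simps)
    finally have ev: "A w = rep_scale \<rho> z w" by simp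
    show ?thesis
    proof (cases "w = 0")
      case True
      then show ?thesis using Suc.IH[of q] \<open>q \<noteq> 0\<close> dq Suc.prems unfolding w_def by simp
    next
      case False
      then show ?thesis using wV ev by blast
    qed
  qed
qed

text \<open>More iterates of \<open>v\<close> than the dimension allows must satisfy a linear
  relation, and its coefficients form a nonzero polynomial annihilating \<open>v\<close>.\<close>

lemma eigenvector_exists:
  assumes AV: "\<And>v. v \<in> V \<Longrightarrow> A v \<in> V"
    and Aadd: "\<And>u v. u \<in> V \<Longrightarrow> v \<in> V \<Longrightarrow> A (u + v) = A u + A v"
    and Asc: "\<And>c v. v \<in> V \<Longrightarrow> A (rep_scale \<rho> c v) = rep_scale \<rho> c (A v)"
    and "V \<noteq> {0}"
  shows "\<exists>c w. w \<in> V \<and> w \<noteq> 0 \<and> A w = rep_scale \<rho> c w"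
proof -
  obtain v where v: "v \<in> V" "v \<noteq> 0" using assms(4) subspace_0[OF subspace_V] by blast
  have pow: "(A ^^ i) v \<in> V" for i by (induction i) (use AV v in auto)
  obtain B where B: "finite B" "V = span B" using finite_span_V by blast
  define n where "n = Suc (card B)"
  let ?w = "\<lambda>i. (A ^^ i) v"
  \<comment> \<open>Linear dependence is a property of sets and does not see repeated iterates. If
    two iterates coincide, their difference is the required relation, with coefficients 1 and
    -1.\<close>
  have "\<exists>a. (\<exists>i<n. a i \<noteq> 0) \<and> (\<Sum>i<n. rep_scale \<rho> (a i) (?w i)) = 0"
  proof (cases "inj_on ?w {..<n}")
    case True
    have "card (?w ` {..<n}) = n" using card_image[OF True] by simp
    then have "dependent (?w ` {..<n})"
      using independent_span_bound[of B "?w ` {..<n}"] B pow unfolding n_def by auto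
    then obtain u where u: "(\<Sum>x\<in>?w ` {..<n}. rep_scale \<rho> (u x) x) = 0" "\<exists>x\<in>?w ` {..<n}. u x \<noteq> 0"
      unfolding dependent_finite[OF finite_imageI[OF finite_lessThan]] by blast
    then show ?thesis using True by (intro exI[of _ "\<lambda>i. u (?w i)"]) (auto simp: sum.reindex)
  next
    case False
    then obtain i j where ij: "i < n" "j < n" "i \<noteq> j" "?w i = ?w j" by (auto simp: inj_on_def)
    define a :: "nat \<Rightarrow> complex" where "a k = (if k = i then 1 else 0) - (if k = j then 1 else 0)" for k
    have "(\<Sum>k<n. rep_scale \<rho> (a k) (?w k)) =
      (\<Sum>k<n. if k = i then ?w k else 0) - (\<Sum>k<n. if k = j then ?w k else 0)"
      unfolding sum_subtractf[symmetric] by (intro sum.cong refl) (auto simp: a_def)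
    also have "\<dots> = 0" using ij by simp
    finally show ?thesis using ij by (intro exI[of _ a]) (auto simp: a_def)
  qed
  then obtain a where a: "\<exists>i<n. a i \<noteq> 0" "(\<Sum>i<n. rep_scale \<rho> (a i) (?w i)) = 0" by blast
  define p where "p = (\<Sum>i<n. monom (a i) i)"
  have c: "coeff p i = (if i < n then a i else 0)" for i
    by (simp add: p_def coeff_sum if_distrib cong: if_cong)
  have "p \<noteq> 0" using a(1) c by (metis coeff_0)
  moreover have "degree p < n" using a(1) c \<open>p \<noteq> 0\<close> by (metis leading_coeff_0_iff)
  moreover have "(\<Sum>i<n. rep_scale \<rho> (coeff p i) (?w i)) = 0" using a(2) by (simp add: c)
  ultimately show ?thesis using eigenvector_of_annihilator[OF AV Aadd Asc v] by blast
qed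

end

section \<open>Intertwiners and Schur's lemma\<close>

text \<open>Only the values on \<open>rep_space \<rho>\<close> are constrained, so identities
  between intertwiners are always stated pointwise on that space.\<close>

definition intertwiner ::
  "('g, 'b) monoid_scheme \<Rightarrow> ('g, 'v::ab_group_add) rep \<Rightarrow> ('g, 'w::ab_group_add) rep \<Rightarrow> ('v \<Rightarrow> 'w) \<Rightarrow> bool"
  where
  "intertwiner G \<rho> \<sigma> T \<longleftrightarrow> linear_between \<rho> \<sigma> T \<and>
     (\<forall>g\<in>carrier G. \<forall>v\<in>rep_space \<rho>. T (rep_act \<rho> g v) = rep_act \<sigma> g (T v))"

lemma intertwinerI:
  assumes "\<And>v. v \<in> rep_space \<rho> \<Longrightarrow> T v \<in> rep_space \<sigma>"
    "\<And>u v. u \<in> rep_space \<rho> \<Longrightarrow> v \<in> rep_space \<rho> \<Longrightarrow> T (u + v) = T u + T v"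
    "\<And>c v. v \<in> rep_space \<rho> \<Longrightarrow> T (rep_scale \<rho> c v) = rep_scale \<sigma> c (T v)"
    "\<And>g v. g \<in> carrier G \<Longrightarrow> v \<in> rep_space \<rho> \<Longrightarrow> T (rep_act \<rho> g v) = rep_act \<sigma> g (T v)"
  shows "intertwiner G \<rho> \<sigma> T"
  using assms unfolding intertwiner_def linear_between_def by blast

lemma intertwinerD:
  assumes "intertwiner G \<rho> \<sigma> T"
  shows "v \<in> rep_space \<rho> \<Longrightarrow> T v \<in> rep_space \<sigma>"
    "u \<in> rep_space \<rho> \<Longrightarrow> v \<in> rep_space \<rho> \<Longrightarrow> T (u + v) = T u + T v"
    "v \<in> rep_space \<rho> \<Longrightarrow> T (rep_scale \<rho> c v) = rep_scale \<sigma> c (T v)"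
    "g \<in> carrier G \<Longrightarrow> v \<in> rep_space \<rho> \<Longrightarrow> T (rep_act \<rho> g v) = rep_act \<sigma> g (T v)"
  using assms unfolding intertwiner_def linear_between_def by blast+

lemma equiv_rep_iff_intertwiner:
  "equiv_rep G \<rho> \<sigma> \<longleftrightarrow> (\<exists>T. intertwiner G \<rho> \<sigma> T \<and> bij_betw T (rep_space \<rho>) (rep_space \<sigma>))"
  unfolding equiv_rep_def intertwiner_def by blast

lemma intertwiner_comp:
  assumes "intertwiner G \<rho> \<sigma> S" "intertwiner G \<sigma> \<tau> T"
  shows "intertwiner G \<rho> \<tau> (\<lambda>v. T (S v))"
  by (rule intertwinerI) (simp_all add: intertwinerD[OF assms(1)] intertwinerD[OF assms(2)])

lemma subrep_simps [simp]:
  "rep_space (subrep \<rho> W) = W" "rep_scale (subrep \<rho> W) = rep_scale \<rho>"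
  "rep_inner (subrep \<rho> W) = rep_inner \<rho>" "rep_act (subrep \<rho> W) = rep_act \<rho>"
  by (simp_all add: subrep_def)

locale urep = group G for G :: "('g, 'b) monoid_scheme" (structure) +
  fixes \<rho> :: "('g, 'v::ab_group_add) rep"
  assumes unitary: "unitary_rep G \<rho>"
begin

sublocale fd_inner \<rho>
  using unitary unfolding unitary_rep_def by unfold_locales blast

abbreviation "act \<equiv> rep_act \<rho>"

lemma linear_act: "g \<in> carrier G \<Longrightarrow> linear_between \<rho> \<rho> (act g)"
  using unitary unfolding unitary_rep_def by blast

lemma act_in: "g \<in> carrier G \<Longrightarrow> v \<in> V \<Longrightarrow> act g v \<in> V"
  using linear_act unfolding linear_between_def by blast

lemma act_add: "g \<in> carrier G \<Longrightarrow> u \<in> V \<Longrightarrow> v \<in> V \<Longrightarrow> act g (u + v) = act g u + act g v"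
  using linear_act unfolding linear_between_def by blast

lemma act_scale: "g \<in> carrier G \<Longrightarrow> v \<in> V \<Longrightarrow> act g (rep_scale \<rho> c v) = rep_scale \<rho> c (act g v)"
  using linear_act unfolding linear_between_def by blast

lemma act_one: "v \<in> V \<Longrightarrow> act \<one> v = v"
  using unitary unfolding unitary_rep_def by blast

lemma act_mult: "g \<in> carrier G \<Longrightarrow> h \<in> carrier G \<Longrightarrow> v \<in> V \<Longrightarrow> act (g \<otimes> h) v = act g (act h v)"
  using unitary unfolding unitary_rep_def by blast

lemma act_inner: "g \<in> carrier G \<Longrightarrow> u \<in> V \<Longrightarrow> v \<in> V \<Longrightarrow> ip (act g u) (act g v) = ip u v"
  using unitary unfolding unitary_rep_def by blast

lemma act_inv: "g \<in> carrier G \<Longrightarrow> v \<in> V \<Longrightarrow> act g (act (inv g) v) = v"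
  using act_mult[of g "inv g" v] by (simp add: act_one)

lemma act_adj: "g \<in> carrier G \<Longrightarrow> u \<in> V \<Longrightarrow> v \<in> V \<Longrightarrow> ip (act g u) v = ip u (act (inv g) v)"
  using act_inner[of g u "act (inv g) v"] by (simp add: act_inv act_in)

lemma act_zero: "g \<in> carrier G \<Longrightarrow> act g 0 = 0"
  using act_scale[of g 0 0] subspace_0[OF subspace_V] by simp

lemma act_diff: "g \<in> carrier G \<Longrightarrow> u \<in> V \<Longrightarrow> v \<in> V \<Longrightarrow> act g (u - v) = act g u - act g v"
  using act_add[of g "u - v" v] subspace_diff[OF subspace_V, of u v] by simp

section \<open>Invariant subspaces and complete reducibility\<close>

lemma invariantD:
  assumes "invariant_subspace G \<rho> W"
  shows "W \<subseteq> V" "subspace W" "g \<in> carrier G \<Longrightarrow> w \<in> W \<Longrightarrow> act g w \<in> W"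
  using assms unfolding invariant_subspace_def by blast+

lemma invariant_V: "invariant_subspace G \<rho> V"
  unfolding invariant_subspace_def using subspace_V act_in by blast

text \<open>Unitarity makes the action of \<open>inv g\<close> adjoint to that of \<open>g\<close>,
  and \<open>U\<close> is stable under \<open>inv g\<close>.\<close>

lemma invariant_orthogonal:
  assumes W: "invariant_subspace G \<rho> W" and U: "invariant_subspace G \<rho> U"
  shows "invariant_subspace G \<rho> {w \<in> W. \<forall>u\<in>U. ip w u = 0}"
proof -
  have "ip (act g w) u = 0" if "g \<in> carrier G" "w \<in> W" "u \<in> U" "\<forall>u\<in>U. ip w u = 0" for g w u
    using that act_adj[of g w u] invariantD(1)[OF W] invariantD(1,3)[OF U] by auto
  then show ?thesis
    unfolding invariant_subspace_def
    using invariantD[OF W] subspace_orthogonal[of W U] invariantD[OF U] by auto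
qed

lemma invariant_subrep_iff:
  assumes "invariant_subspace G \<rho> W"
  shows "invariant_subspace G (subrep \<rho> W) U \<longleftrightarrow> invariant_subspace G \<rho> U \<and> U \<subseteq> W"
  using assms unfolding invariant_subspace_def by auto

lemma unitary_subrep:
  assumes "invariant_subspace G \<rho> W"
  shows "unitary_rep G (subrep \<rho> W)"
proof -
  note W = invariantD[OF assms]
  have WV: "v \<in> V" if "v \<in> W" for v using W(1) that by blast
  have "fin_dim_inner_space (subrep \<rho> W)"
    unfolding fin_dim_inner_space_def subrep_simps
  proof (intro conjI ballI allI impI)
    show "\<exists>B. finite B \<and> W = span B" using subspace_basis[of W] W by blast
    show "vector_space (rep_scale \<rho>)" by (rule vector_space_axioms)
    show "ip (u + v) w = ip u w + ip v w" if "u \<in> W" "v \<in> W" "w \<in> W" for u v w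
      using that by (intro ip_add_left WV)
    show "ip (rep_scale \<rho> c u) v = c * ip u v" if "u \<in> W" "v \<in> W" for c u v
      using that by (intro ip_scale_left WV)
    show "ip v u = cnj (ip u v)" if "u \<in> W" "v \<in> W" for u v
      using that by (intro ip_cnj WV)
    show "0 < Re (ip u u)" if "u \<in> W" "u \<noteq> 0" for u
      using that by (intro ip_pos WV)
  qed
  moreover have "linear_between (subrep \<rho> W) (subrep \<rho> W) (act g)" if "g \<in> carrier G" for g
    using linear_act[OF that] W that unfolding linear_between_def subrep_simps by blast
  ultimately show ?thesis
    unfolding unitary_rep_def subrep_simps by (simp add: WV act_one act_mult act_inner)
qed

lemma irreducible_subrep_iff:
  assumes "invariant_subspace G \<rho> W"
  shows "irreducible_rep G (subrep \<rho> W) \<longleftrightarrow>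
    W \<noteq> {0} \<and> (\<forall>U. invariant_subspace G \<rho> U \<longrightarrow> U \<subseteq> W \<longrightarrow> U = {0} \<or> U = W)"
  unfolding irreducible_rep_def using unitary_subrep[OF assms] invariant_subrep_iff[OF assms] by auto

text \<open>A nonzero invariant subspace of \<open>W\<close> of least dimension has no proper
  nonzero invariant subspace.\<close>

lemma irreducible_subspace_exists:
  assumes "invariant_subspace G \<rho> W" "W \<noteq> {0}"
  shows "\<exists>U\<subseteq>W. invariant_subspace G \<rho> U \<and> irreducible_rep G (subrep \<rho> U)"
proof -
  define P where "P U \<longleftrightarrow> invariant_subspace G \<rho> U \<and> U \<subseteq> W \<and> U \<noteq> {0}" for U
  have "P W" using assms by (simp add: P_def)
  then obtain U where U: "P U" "\<And>U'. P U' \<Longrightarrow> dim U \<le> dim U'"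
    using exists_least_lemma arg_min_nat_lemma[of P W dim] by blast
  have "U' = {0} \<or> U' = U" if U': "invariant_subspace G \<rho> U'" "U' \<subseteq> U" for U'
  proof (rule ccontr)
    assume a: "\<not> (U' = {0} \<or> U' = U)"
    then have "P U'" using U' U(1) by (auto simp: P_def)
    moreover have "dim U' < dim U"
      using dim_strict_mono[of U' U] U' U(1) a invariantD unfolding P_def by blast
    ultimately show False using U(2) by fastforce
  qed
  then show ?thesis using U(1) irreducible_subrep_iff unfolding P_def by blast
qed

text \<open>Induction on the dimension: split off an irreducible \<open>U\<close> and decompose its
  orthogonal complement \<open>C\<close> in \<open>W\<close>. Working with invariant subspaces of
  the fixed \<rho> keeps the inner product and the action the same throughout.\<close>

lemma decomposition_exists_invariant:
  assumes "invariant_subspace G \<rho> W"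
  shows "\<exists>D. finite D \<and> (\<forall>U\<in>D. invariant_subspace G \<rho> U \<and> irreducible_rep G (subrep \<rho> U)) \<and>
     (\<forall>U\<in>D. \<forall>U'\<in>D. U \<noteq> U' \<longrightarrow> (\<forall>u\<in>U. \<forall>v\<in>U'. ip u v = 0)) \<and> W = span (\<Union>D)"
  using assms
proof (induction "dim W" arbitrary: W rule: less_induct)
  case less
  note W = invariantD[OF less.prems]
  show ?case
  proof (cases "W = {0}")
    case True
    then show ?thesis by (intro exI[of _ "{}"]) simp
  next
    case False
    then obtain U where U: "U \<subseteq> W" "invariant_subspace G \<rho> U" "irreducible_rep G (subrep \<rho> U)"
      using irreducible_subspace_exists[OF less.prems] by blast
    note Ui = invariantD[OF U(2)]
    define C where "C = {w \<in> W. \<forall>u\<in>U. ip w u = 0}"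
    have C: "invariant_subspace G \<rho> C"
      unfolding C_def by (rule invariant_orthogonal[OF less.prems U(2)])
    note Ci = invariantD[OF C]
    have U0: "U \<noteq> {0}" using U(3) unfolding irreducible_rep_def by simp
    have "C \<noteq> W"
    proof
      assume "C = W"
      then have "\<forall>u\<in>U. ip u u = 0" using U(1) unfolding C_def by auto
      then show False using U0 ip_self_eq_0 Ui subspace_0 by blast
    qed
    then have "C \<subset> W" by (auto simp: C_def)
    then have "dim C < dim W" using dim_strict_mono Ci W by blast
    then obtain D where D: "finite D"
      "\<forall>U\<in>D. invariant_subspace G \<rho> U \<and> irreducible_rep G (subrep \<rho> U)"
      "\<forall>U\<in>D. \<forall>U'\<in>D. U \<noteq> U' \<longrightarrow> (\<forall>u\<in>U. \<forall>v\<in>U'. ip u v = 0)" "C = span (\<Union>D)"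
      using less.hyps[OF _ C] by blast
    have DC: "X \<subseteq> C" if "X \<in> D" for X unfolding D(4) using that span_superset[of "\<Union>D"] by blast
    have orth: "ip u v = 0 \<and> ip v u = 0" if "X \<in> D" "u \<in> U" "v \<in> X" for X u v
    proof -
      have "v \<in> C" using that DC by blast
      then have "ip v u = 0" "v \<in> V" "u \<in> V" using that Ui W unfolding C_def by auto
      then show ?thesis using ip_eq_0_sym by blast
    qed
    have "W = span (\<Union>(insert U D))"
    proof
      show "span (\<Union>(insert U D)) \<subseteq> W"
        using U(1) DC W(2) by (intro span_minimal) (auto simp: C_def)
      show "W \<subseteq> span (\<Union>(insert U D))"
      proof
        fix w assume w: "w \<in> W"
        then have wV: "w \<in> V" using W by blast
        have p: "proj U w \<in> U" using proj_in Ui wV by blast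
        have "w - proj U w \<in> C"
          using w p U(1) subspace_diff[OF W(2)] proj_orth[OF Ui(2,1) wV] unfolding C_def by blast
        then have 1: "w - proj U w \<in> span (\<Union>(insert U D))"
          unfolding D(4) using span_mono[of "\<Union>D" "\<Union>(insert U D)"] by auto
        have 2: "proj U w \<in> span (\<Union>(insert U D))" using p by (intro span_base) auto
        show "w \<in> span (\<Union>(insert U D))" using span_add[OF 1 2] by simp
      qed
    qed
    then show ?thesis
      using D U orth by (intro exI[of _ "insert U D"]) auto
  qed
qed

lemma decomposition_exists: "\<exists>D. irreducible_decomposition G \<rho> D"
  using decomposition_exists_invariant[OF invariant_V] unfolding irreducible_decomposition_def by simp

text \<open>In each case the expected value passes the test of \<open>proj_eqI\<close>; for the
  action, \<open>act_adj\<close> moves \<open>g\<close> to the other argument, where it preserves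
  \<open>W\<close>.\<close>

lemma intertwiner_proj:
  assumes W: "invariant_subspace G \<rho> W"
  shows "intertwiner G \<rho> (subrep \<rho> W) (proj W)"
proof -
  note Wi = invariantD[OF W]
  note pW = proj_in[OF Wi(2,1)] and po = proj_orth[OF Wi(2,1)]
  have pV: "proj W v \<in> V" if "v \<in> V" for v using pW[OF that] Wi by blast
  note sV = subspace_add[OF subspace_V] subspace_scale[OF subspace_V] subspace_diff[OF subspace_V]
  have "proj W (u + v) = proj W u + proj W v" if uv: "u \<in> V" "v \<in> V" for u v
  proof (rule proj_eqI[OF Wi(2,1)])
    fix w assume w: "w \<in> W"
    have "ip ((u - proj W u) + (v - proj W v)) w = 0"
      using uv w pV sV po Wi by (subst ip_add_left) auto
    then show "ip (u + v - (proj W u + proj W v)) w = 0" by (simp add: algebra_simps)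
  qed (use uv pW sV subspace_add[OF Wi(2)] in auto)
  moreover have "proj W (rep_scale \<rho> c v) = rep_scale \<rho> c (proj W v)" if v: "v \<in> V" for c v
  proof (rule proj_eqI[OF Wi(2,1)])
    fix w assume w: "w \<in> W"
    have "ip (rep_scale \<rho> c (v - proj W v)) w = 0"
      using v w pV sV po Wi by (subst ip_scale_left) auto
    then show "ip (rep_scale \<rho> c v - rep_scale \<rho> c (proj W v)) w = 0"
      by (simp add: scale_right_diff_distrib)
  qed (use v pW sV subspace_scale[OF Wi(2)] in auto)
  moreover have "proj W (act g v) = act g (proj W v)" if g: "g \<in> carrier G" and v: "v \<in> V" for g v
  proof (rule proj_eqI[OF Wi(2,1)])
    fix w assume w: "w \<in> W"
    have "ip (act g (v - proj W v)) w = 0"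
      using g v w pV sV po[OF v] Wi(1) Wi(3)[of "inv g" w] by (subst act_adj) auto
    then show "ip (act g v - act g (proj W v)) w = 0" using act_diff g v pV by simp
  qed (use g v pW act_in Wi(3) in auto)
  ultimately show ?thesis using pW by (intro intertwinerI) simp_all
qed

lemma proj_id: "subspace W \<Longrightarrow> W \<subseteq> V \<Longrightarrow> w \<in> W \<Longrightarrow> proj W w = w"
  by (rule proj_eqI) auto

end

section \<open>Kernels and images of intertwiners, Schur's lemma\<close>

lemma irreducible_urep: "group G \<Longrightarrow> irreducible_rep G \<rho> \<Longrightarrow> urep G \<rho>"
  by (simp add: urep_def urep_axioms_def irreducible_rep_def)

lemma intertwiner_zero:
  assumes "urep G \<rho>" "urep G \<sigma>" "intertwiner G \<rho> \<sigma> T"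
  shows "T 0 = 0"
proof -
  interpret r: urep G \<rho> by fact
  interpret s: urep G \<sigma> by fact
  show ?thesis using intertwinerD(3)[OF assms(3), of 0 0] r.subspace_0[OF r.subspace_V] by simp
qed

lemma intertwiner_diff:
  assumes "urep G \<rho>" "urep G \<sigma>" "intertwiner G \<rho> \<sigma> T" "u \<in> rep_space \<rho>" "v \<in> rep_space \<rho>"
  shows "T (u - v) = T u - T v"
proof -
  interpret r: urep G \<rho> by fact
  show ?thesis
    using intertwinerD(2)[OF assms(3), of "u - v" v] r.subspace_diff[OF r.subspace_V] assms(4,5) by simp
qed

lemma intertwiner_sum:
  assumes "urep G \<rho>" "urep G \<sigma>" "intertwiner G \<rho> \<sigma> T" "\<And>i. i \<in> I \<Longrightarrow> f i \<in> rep_space \<rho>"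
  shows "T (\<Sum>i\<in>I. f i) = (\<Sum>i\<in>I. T (f i))"
  using assms(4)
proof (induction I rule: infinite_finite_induct)
  case (insert i I)
  interpret r: urep G \<rho> by fact
  have "(\<Sum>i\<in>I. f i) \<in> rep_space \<rho>" using insert by (intro r.subspace_sum[OF r.subspace_V]) auto
  then show ?case using insert intertwinerD(2)[OF assms(3)] by simp
qed (use intertwiner_zero[OF assms(1-3)] in simp_all)

lemma intertwiner_inj_on:
  assumes "urep G \<rho>" "urep G \<sigma>" "intertwiner G \<rho> \<sigma> T"
    and "\<And>v. v \<in> rep_space \<rho> \<Longrightarrow> T v = 0 \<Longrightarrow> v = 0"
  shows "inj_on T (rep_space \<rho>)"
proof (rule inj_onI)
  interpret r: urep G \<rho> by fact
  fix u v assume "u \<in> rep_space \<rho>" "v \<in> rep_space \<rho>" "T u = T v"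
  then show "u = v"
    using intertwiner_diff[OF assms(1-3)] assms(4)[of "u - v"] r.subspace_diff[OF r.subspace_V] by simp
qed

lemma invariant_preimage:
  assumes "urep G \<rho>" "urep G \<sigma>" "intertwiner G \<rho> \<sigma> T" "invariant_subspace G \<sigma> W"
  shows "invariant_subspace G \<rho> {v \<in> rep_space \<rho>. T v \<in> W}"
proof -
  interpret r: urep G \<rho> by fact
  interpret s: urep G \<sigma> by fact
  note W = s.invariantD[OF assms(4)]
  show ?thesis
    unfolding invariant_subspace_def
    using W intertwiner_zero[OF assms(1-3)] r.act_in
    by (auto intro!: r.subspaceI simp: intertwinerD[OF assms(3)] r.subspace_0 r.subspace_add
        r.subspace_scale r.subspace_V s.subspace_0 s.subspace_add s.subspace_scale)
qed

lemma invariant_image: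
  assumes "urep G \<rho>" "urep G \<sigma>" "intertwiner G \<rho> \<sigma> T"
  shows "invariant_subspace G \<sigma> (T ` rep_space \<rho>)"
proof -
  interpret r: urep G \<rho> by fact
  interpret s: urep G \<sigma> by fact
  note T = intertwinerD[OF assms(3)]
  have "s.subspace (T ` rep_space \<rho>)"
  proof (rule s.subspaceI)
    show "0 \<in> T ` rep_space \<rho>"
      using intertwiner_zero[OF assms] r.subspace_0[OF r.subspace_V] by (metis imageI)
    show "x + y \<in> T ` rep_space \<rho>" if "x \<in> T ` rep_space \<rho>" "y \<in> T ` rep_space \<rho>" for x y
      using that T(2) r.subspace_add[OF r.subspace_V] by (auto simp: image_iff) metis
    show "rep_scale \<sigma> c x \<in> T ` rep_space \<rho>" if "x \<in> T ` rep_space \<rho>" for c x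
      using that T(3) r.subspace_scale[OF r.subspace_V] by (auto simp: image_iff) metis
  qed
  moreover have "rep_act \<sigma> g (T v) \<in> T ` rep_space \<rho>" if "g \<in> carrier G" "v \<in> rep_space \<rho>" for g v
    using that T(4)[of g v] r.act_in by (metis imageI)
  ultimately show ?thesis unfolding invariant_subspace_def using T(1) by auto
qed

text \<open>Irreducibility of \<rho> makes the kernel trivial or everything; irreducibility of
  \<sigma> does the same for the image.\<close>

lemma schur_zero_or_bij:
  assumes "group G" "irreducible_rep G \<rho>" "irreducible_rep G \<sigma>" "intertwiner G \<rho> \<sigma> T"
  shows "(\<forall>v\<in>rep_space \<rho>. T v = 0) \<or> bij_betw T (rep_space \<rho>) (rep_space \<sigma>)"
proof -
  note u = irreducible_urep[OF assms(1,2)] irreducible_urep[OF assms(1,3)]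
  interpret r: urep G \<rho> by fact
  interpret s: urep G \<sigma> by fact
  have "invariant_subspace G \<sigma> {0}"
    unfolding invariant_subspace_def using s.act_zero s.subspace_0[OF s.subspace_V] by simp
  then have "invariant_subspace G \<rho> {v \<in> rep_space \<rho>. T v \<in> {0}}"
    by (rule invariant_preimage[OF u assms(4)])
  then have "{v \<in> rep_space \<rho>. T v = 0} = {0} \<or> {v \<in> rep_space \<rho>. T v = 0} = rep_space \<rho>"
    using assms(2) unfolding irreducible_rep_def by simp
  then show ?thesis
  proof
    assume k: "{v \<in> rep_space \<rho>. T v = 0} = {0}"
    have inj: "inj_on T (rep_space \<rho>)"
      by (rule intertwiner_inj_on[OF u assms(4)]) (use k in blast)
    have "T ` rep_space \<rho> = {0} \<or> T ` rep_space \<rho> = rep_space \<sigma>"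
      using invariant_image[OF u assms(4)] assms(3) unfolding irreducible_rep_def by blast
    moreover have "T ` rep_space \<rho> \<noteq> {0}"
    proof
      assume "T ` rep_space \<rho> = {0}"
      then have "rep_space \<rho> \<subseteq> {v \<in> rep_space \<rho>. T v = 0}" by blast
      then show False using k assms(2) r.subspace_0[OF r.subspace_V] unfolding irreducible_rep_def by blast
    qed
    ultimately show ?thesis using inj unfolding bij_betw_def by blast
  qed blast
qed

text \<open>For an eigenvalue \<open>c\<close> of \<open>T\<close> the intertwiner
  \<open>T - c\<close> kills an eigenvector, so it is not injective and must vanish.\<close>

lemma schur_scalar:
  assumes "group G" "irreducible_rep G \<rho>" "intertwiner G \<rho> \<rho> T"
  shows "\<exists>c. \<forall>v\<in>rep_space \<rho>. T v = rep_scale \<rho> c v"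
proof -
  note u = irreducible_urep[OF assms(1,2)]
  interpret r: urep G \<rho> by fact
  note T = intertwinerD[OF assms(3)]
  have "rep_space \<rho> \<noteq> {0}" using assms(2) unfolding irreducible_rep_def by blast
  then obtain c w where w: "w \<in> rep_space \<rho>" "w \<noteq> 0" "T w = rep_scale \<rho> c w"
    using r.eigenvector_exists[of T] T by blast
  define S where "S v = T v - rep_scale \<rho> c v" for v
  note sV = r.subspace_add[OF r.subspace_V] r.subspace_scale[OF r.subspace_V] r.subspace_diff[OF r.subspace_V]
  have S: "intertwiner G \<rho> \<rho> S"
    by (rule intertwinerI)
      (simp_all add: S_def T sV r.scale_right_distrib r.scale_right_diff_distrib r.scale_left_commute[of _ c]
        r.act_diff r.act_scale r.act_in)
  have "\<not> inj_on S (rep_space \<rho>)"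
    using w intertwiner_zero[OF u u S] r.subspace_0[OF r.subspace_V] unfolding inj_on_def S_def by force
  then have "\<forall>v\<in>rep_space \<rho>. S v = 0"
    using schur_zero_or_bij[OF assms(1,2,2) S] bij_betw_imp_inj_on by blast
  then show ?thesis unfolding S_def by auto
qed

lemma intertwiner_inverse:
  assumes "urep G \<rho>" "urep G \<sigma>" "intertwiner G \<rho> \<sigma> T" "bij_betw T (rep_space \<rho>) (rep_space \<sigma>)"
  shows "intertwiner G \<sigma> \<rho> (the_inv_into (rep_space \<rho>) T)"
proof -
  interpret r: urep G \<rho> by fact
  interpret s: urep G \<sigma> by fact
  let ?S = "the_inv_into (rep_space \<rho>) T"
  note T = intertwinerD[OF assms(3)]
  have inj: "inj_on T (rep_space \<rho>)" and im: "T ` rep_space \<rho> = rep_space \<sigma>"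
    using assms(4) unfolding bij_betw_def by blast+
  have S: "?S w \<in> rep_space \<rho>" "T (?S w) = w" if "w \<in> rep_space \<sigma>" for w
    using that inj im the_inv_into_into[OF inj, of w "rep_space \<rho>"] f_the_inv_into_f[OF inj] by auto
  note sV = r.subspace_add[OF r.subspace_V] r.subspace_scale[OF r.subspace_V]
  show ?thesis
    by (rule intertwinerI) (simp_all add: the_inv_into_f_eq[OF inj] S T sV r.act_in)
qed

text \<open>Apply \<open>schur_scalar\<close> to \<open>T\<close> followed by the inverse of
  \<open>S\<close>. This is the uniqueness up to scalars of the intertwiner from a conjugate of
  \<theta> to \<theta>.\<close>

lemma schur_proportional:
  assumes "group G" "irreducible_rep G \<rho>" "irreducible_rep G \<sigma>"
    and S: "intertwiner G \<rho> \<sigma> S" "bij_betw S (rep_space \<rho>) (rep_space \<sigma>)"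
    and T: "intertwiner G \<rho> \<sigma> T"
  shows "\<exists>c. \<forall>v\<in>rep_space \<rho>. T v = rep_scale \<sigma> c (S v)"
proof -
  note u = irreducible_urep[OF assms(1,2)] irreducible_urep[OF assms(1,3)]
  let ?R = "the_inv_into (rep_space \<rho>) S"
  have inj: "inj_on S (rep_space \<rho>)" and im: "S ` rep_space \<rho> = rep_space \<sigma>"
    using S(2) unfolding bij_betw_def by blast+
  have "intertwiner G \<rho> \<rho> (\<lambda>v. ?R (T v))"
    by (rule intertwiner_comp[OF T intertwiner_inverse[OF u S]])
  then obtain c where c: "\<forall>v\<in>rep_space \<rho>. ?R (T v) = rep_scale \<rho> c v"
    using schur_scalar[OF assms(1,2)] by blast
  have "T v = rep_scale \<sigma> c (S v)" if v: "v \<in> rep_space \<rho>" for v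
  proof -
    have "T v = S (?R (T v))"
      using f_the_inv_into_f[OF inj] im intertwinerD(1)[OF T v] by metis
    also have "\<dots> = S (rep_scale \<rho> c v)" using c v by simp
    finally show ?thesis using intertwinerD(3)[OF S(1)] v by simp
  qed
  then show ?thesis by blast
qed

section \<open>Equivalence of representations\<close>

lemma equiv_rep_sym:
  assumes "urep G \<rho>" "urep G \<sigma>" "equiv_rep G \<rho> \<sigma>"
  shows "equiv_rep G \<sigma> \<rho>"
  using assms intertwiner_inverse bij_betw_the_inv_into unfolding equiv_rep_iff_intertwiner by blast

lemma equiv_rep_trans:
  assumes "equiv_rep G \<rho> \<sigma>" "equiv_rep G \<sigma> \<tau>"
  shows "equiv_rep G \<rho> \<tau>"
proof -
  obtain S T where "intertwiner G \<rho> \<sigma> S" "bij_betw S (rep_space \<rho>) (rep_space \<sigma>)"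
    "intertwiner G \<sigma> \<tau> T" "bij_betw T (rep_space \<sigma>) (rep_space \<tau>)"
    using assms unfolding equiv_rep_iff_intertwiner by blast
  then have "intertwiner G \<rho> \<tau> (\<lambda>v. T (S v))" "bij_betw (\<lambda>v. T (S v)) (rep_space \<rho>) (rep_space \<tau>)"
    using intertwiner_comp bij_betw_trans[of S _ _ T] by (auto simp: comp_def)
  then show ?thesis unfolding equiv_rep_iff_intertwiner by blast
qed

text \<open>Invariant subspaces are pulled back along the equivalence. An equivalence need not be
  isometric, so unitarity of \<sigma> is assumed separately.\<close>

lemma irreducible_equiv:
  assumes "group G" "irreducible_rep G \<rho>" "unitary_rep G \<sigma>" "equiv_rep G \<rho> \<sigma>"
  shows "irreducible_rep G \<sigma>"
proof -
  have u: "urep G \<rho>" "urep G \<sigma>"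
    using assms irreducible_urep by (auto simp: urep_def urep_axioms_def)
  interpret r: urep G \<rho> by fact
  obtain T where T: "intertwiner G \<rho> \<sigma> T" "bij_betw T (rep_space \<rho>) (rep_space \<sigma>)"
    using assms(4) unfolding equiv_rep_iff_intertwiner by blast
  have im: "T ` rep_space \<rho> = rep_space \<sigma>" using T(2) unfolding bij_betw_def by blast
  have inj: "inj_on T (rep_space \<rho>)" using T(2) unfolding bij_betw_def by blast
  have T0: "T 0 = 0" by (rule intertwiner_zero[OF u T(1)])
  have 0: "0 \<in> rep_space \<rho>" using r.subspace_0[OF r.subspace_V] .
  have "W = {0} \<or> W = rep_space \<sigma>" if W: "invariant_subspace G \<sigma> W" for W
  proof -
    let ?U = "{v \<in> rep_space \<rho>. T v \<in> W}"
    have "W \<subseteq> rep_space \<sigma>" using W unfolding invariant_subspace_def by blast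
    then have "W = T ` ?U" using im by auto
    moreover have "?U = {0} \<or> ?U = rep_space \<rho>"
      using invariant_preimage[OF u T(1) W] assms(2) unfolding irreducible_rep_def by blast
    ultimately show ?thesis using T0 im by auto
  qed
  moreover have "rep_space \<sigma> \<noteq> {0}"
  proof
    assume "rep_space \<sigma> = {0}"
    then have "v = 0" if "v \<in> rep_space \<rho>" for v
      using im T0 that 0 inj_onD[OF inj, of v 0] by auto
    then have "rep_space \<rho> = {0}" using 0 by blast
    then show False using assms(2) unfolding irreducible_rep_def by blast
  qed
  ultimately show ?thesis using assms(3) unfolding irreducible_rep_def by blast
qed

section \<open>Multiplicity-free representations\<close>

text \<open>The inner product and the action are carried over through the inverse \<open>R\<close>
  of \<open>T\<close>, so that \<open>T\<close> becomes an isometric equivalence onto its image.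
  This serves to change the ambient type of a representation.\<close>

lemma (in urep) transport:
  fixes T :: "'v \<Rightarrow> 'w::ab_group_add" and s :: "complex \<Rightarrow> 'w \<Rightarrow> 'w"
  assumes "vector_space s"
    and add: "\<And>u v. u \<in> V \<Longrightarrow> v \<in> V \<Longrightarrow> T (u + v) = T u + T v"
    and scale: "\<And>c v. v \<in> V \<Longrightarrow> T (rep_scale \<rho> c v) = s c (T v)"
    and inj: "inj_on T V"
  shows "\<exists>\<sigma> :: ('g, 'w) rep. unitary_rep G \<sigma> \<and> equiv_rep G \<rho> \<sigma>"
proof -
  interpret w: vector_space s by fact
  define R where "R = the_inv_into V T"
  have R: "R (T v) = v" if "v \<in> V" for v using that inj by (simp add: R_def the_inv_into_f_f)
  define \<sigma> where "\<sigma> = \<lparr>rep_space = T ` V, rep_scale = s, rep_inner = (\<lambda>x y. ip (R x) (R y)),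
    rep_act = (\<lambda>g x. T (act g (R x)))\<rparr>"
  have sp [simp]: "rep_space \<sigma> = T ` V" "rep_scale \<sigma> = s" "rep_inner \<sigma> x y = ip (R x) (R y)"
    "rep_act \<sigma> g x = T (act g (R x))" for x y g
    by (simp_all add: \<sigma>_def)
  note sV = subspace_add[OF subspace_V] subspace_scale[OF subspace_V]
  have T0: "T 0 = 0" using scale[of 0 0] subspace_0[OF subspace_V] by simp
  obtain B where B: "finite B" "V = span B" using finite_span_V by blast
  have BV: "B \<subseteq> V" unfolding B by (rule span_superset)
  have subT: "w.subspace (T ` V)"
  proof (rule w.subspaceI)
    show "0 \<in> T ` V" using T0 subspace_0[OF subspace_V] by (metis imageI)
    show "x + y \<in> T ` V" if "x \<in> T ` V" "y \<in> T ` V" for x y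
      using that by (auto simp: add[symmetric] sV)
    show "s c x \<in> T ` V" if "x \<in> T ` V" for c x
      using that by (auto simp: scale[symmetric] sV)
  qed
  \<comment> \<open>The vectors whose image lies in the span of \<open>T\<close>
    B\<open>form a subspace containing\<close>B\<open>; hence the finite set\<close>T
    \<open>B\<close> generates the image.\<close>
  have "subspace {v \<in> V. T v \<in> w.span (T ` B)}"
    by (intro subspaceI)
      (auto simp: T0 subspace_0[OF subspace_V] sV add scale w.span_zero w.span_add w.span_scale)
  then have "span B \<subseteq> {v \<in> V. T v \<in> w.span (T ` B)}"
    using BV by (intro span_minimal) (auto intro: w.span_base)
  then have "T ` V \<subseteq> w.span (T ` B)" using B by auto
  moreover have "w.span (T ` B) \<subseteq> T ` V" using BV subT by (intro w.span_minimal) auto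
  ultimately have "T ` V = w.span (T ` B)" by blast
  then have fin: "\<exists>B'. finite B' \<and> T ` V = w.span B'" using B(1) by blast
  have "fin_dim_inner_space \<sigma>"
    unfolding fin_dim_inner_space_def sp
  proof (intro conjI ballI allI impI)
    show "vector_space s" by fact
    show "\<exists>B'. finite B' \<and> T ` V = w.span B'" by (fact fin)
  next
    fix x y z assume "x \<in> T ` V" "y \<in> T ` V" "z \<in> T ` V"
    then show "ip (R (x + y)) (R z) = ip (R x) (R z) + ip (R y) (R z)"
      by (auto simp: add[symmetric] sV R ip_add_left)
  next
    fix c x y assume "x \<in> T ` V" "y \<in> T ` V"
    then show "ip (R (s c x)) (R y) = c * ip (R x) (R y)"
      by (auto simp: scale[symmetric] sV R ip_scale_left)
  next
    fix x y assume "x \<in> T ` V" "y \<in> T ` V"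
    then obtain u v where "x = T u" "u \<in> V" "y = T v" "v \<in> V" by blast
    then show "ip (R y) (R x) = cnj (ip (R x) (R y))" using ip_cnj[of u v] by (simp add: R)
  next
    fix x assume "x \<in> T ` V" "x \<noteq> 0"
    then obtain u where "x = T u" "u \<in> V" "u \<noteq> 0" using T0 by blast
    then show "0 < Re (ip (R x) (R x))" using ip_pos by (simp add: R)
  qed
  moreover have "linear_between \<sigma> \<sigma> (rep_act \<sigma> g)" if g: "g \<in> carrier G" for g
    unfolding linear_between_def sp using g
    by (auto simp: R act_in act_add act_scale sV add[symmetric] scale[symmetric])
  ultimately have uni: "unitary_rep G \<sigma>"
    unfolding unitary_rep_def
    by (auto simp: R act_in act_one act_mult act_inner)
  have "intertwiner G \<rho> \<sigma> T"
    by (rule intertwinerI) (auto simp: add scale R)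
  then have "equiv_rep G \<rho> \<sigma>"
    unfolding equiv_rep_iff_intertwiner using inj by (auto simp: bij_betw_def)
  then show ?thesis using uni by blast
qed

text \<open>Coordinates with respect to a finite basis, padded by zeros, embed \<open>V\<close> into
  the sequences. Such copies are needed because \<open>multiplicity_free\<close> and
  \<open>I_hat\<close> range over \<open>std_rep\<close>.\<close>

lemma (in urep) std_copy_exists: "\<exists>\<sigma> :: 'g std_rep. unitary_rep G \<sigma> \<and> equiv_rep G \<rho> \<sigma>"
proof -
  obtain B where B: "finite B" "independent B" "span B = V" using subspace_basis[OF subspace_V] by blast
  obtain b where b: "bij_betw b {0..<card B} B" using ex_bij_betw_nat_finite[OF B(1)] by blast
  define T :: "'v \<Rightarrow> nat \<Rightarrow> complex"
    where "T v i = (if i < card B then representation B v (b i) else 0)" for v i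
  have "inj_on T V"
  proof (rule inj_onI)
    fix u v assume uv: "u \<in> V" "v \<in> V" "T u = T v"
    have "representation B u x = representation B v x" if "x \<in> B" for x
    proof -
      have "x \<in> b ` {0..<card B}" unfolding bij_betw_imp_surj_on[OF b] by (rule that)
      then obtain i where "i < card B" "b i = x" by auto
      then show ?thesis using fun_cong[OF uv(3), of i] by (simp add: T_def)
    qed
    then have "(\<Sum>x\<in>B. rep_scale \<rho> (representation B u x) x) = (\<Sum>x\<in>B. rep_scale \<rho> (representation B v x) x)"
      by simp
    then show "u = v" using sum_representation_eq[OF B(2) _ B(1) subset_refl] uv B(3) by simp
  qed
  moreover have "vector_space (\<lambda>c (f::nat \<Rightarrow> complex) i. c * f i)"
    by unfold_locales (auto simp: algebra_simps fun_eq_iff)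
  ultimately show ?thesis
    by (intro transport[where T = T]) (auto simp: T_def fun_eq_iff representation_add representation_scale B)
qed

lemma irreducible_std_copy_exists:
  fixes G :: "('g, 'b) monoid_scheme" and \<rho> :: "('g, 'v::ab_group_add) rep"
  assumes "group G" "irreducible_rep G \<rho>"
  shows "\<exists>\<sigma> :: 'g std_rep. irreducible_rep G \<sigma> \<and> equiv_rep G \<sigma> \<rho>"
proof -
  note u = irreducible_urep[OF assms]
  obtain \<sigma> :: "'g std_rep" where s: "unitary_rep G \<sigma>" "equiv_rep G \<rho> \<sigma>"
    using urep.std_copy_exists[OF u] by blast
  then have "irreducible_rep G \<sigma>" using irreducible_equiv assms by blast
  then show ?thesis using s equiv_rep_sym[OF u irreducible_urep] assms(1) by blast
qed

section \<open>Multiplicities and the endomorphism algebra\<close>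

context urep
begin

text \<open>The same choice as in \<open>multiplicity\<close>, so that multiplicities are counts of
  members of \<open>dec\<close>.\<close>

definition dec :: "'v set set" where
  "dec = (SOME D. irreducible_decomposition G \<rho> D)"

lemma dec: "irreducible_decomposition G \<rho> dec"
  unfolding dec_def by (rule someI_ex[OF decomposition_exists])

lemma finite_dec: "finite dec"
  using dec unfolding irreducible_decomposition_def by blast

lemma dec_invariant: "U \<in> dec \<Longrightarrow> invariant_subspace G \<rho> U"
  using dec unfolding irreducible_decomposition_def by blast

lemma dec_irreducible: "U \<in> dec \<Longrightarrow> irreducible_rep G (subrep \<rho> U)"
  using dec unfolding irreducible_decomposition_def by blast

lemma dec_orthogonal: "U \<in> dec \<Longrightarrow> U' \<in> dec \<Longrightarrow> U \<noteq> U' \<Longrightarrow> u \<in> U \<Longrightarrow> v \<in> U' \<Longrightarrow> ip u v = 0"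
  using dec unfolding irreducible_decomposition_def by blast

lemma dec_span: "V = span (\<Union>dec)"
  using dec unfolding irreducible_decomposition_def by blast

lemma dec_orthogonal_eq_0:
  assumes "v \<in> V" "\<And>U u. U \<in> dec \<Longrightarrow> u \<in> U \<Longrightarrow> ip v u = 0"
  shows "v = 0"
proof -
  have "ip v v = 0"
    using orthogonal_span[of v "\<Union>dec" v] assms dec_span invariantD(1)[OF dec_invariant] by blast
  then show ?thesis using ip_self_eq_0 assms by blast
qed

lemma dec_proj:
  assumes "U \<in> dec" "v \<in> V"
  shows dec_proj_in: "proj U v \<in> U" and dec_proj_orth: "u \<in> U \<Longrightarrow> ip (v - proj U v) u = 0"
    and dec_proj_in_V: "proj U v \<in> V"
  using proj[of U v] invariantD[OF dec_invariant[OF assms(1)]] assms(2) by blast+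

text \<open>The defect \<open>v - ?s\<close> is orthogonal to every summand, since against a vector
  of \<open>U\<close> only the projection to \<open>U\<close> contributes; the summands span the
  space.\<close>

lemma sum_proj_dec:
  assumes v: "v \<in> V"
  shows "(\<Sum>U\<in>dec. proj U v) = v"
proof -
  let ?s = "\<Sum>U\<in>dec. proj U v"
  have sV: "?s \<in> V" using dec_proj_in_V v by (intro subspace_sum[OF subspace_V]) auto
  have "v - ?s = 0"
  proof (rule dec_orthogonal_eq_0)
    show "v - ?s \<in> V" using subspace_diff[OF subspace_V] v sV by blast
    fix U u assume U: "U \<in> dec" "u \<in> U"
    have uV: "u \<in> V" using U invariantD(1)[OF dec_invariant] by blast
    have "ip ?s u = (\<Sum>U'\<in>dec. ip (proj U' v) u)"
      by (rule ip_sum_left) (use dec_proj_in_V v uV in auto)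
    also have "\<dots> = (\<Sum>U'\<in>dec. if U' = U then ip (proj U v) u else 0)"
      using dec_orthogonal dec_proj_in v U by (intro sum.cong refl) auto
    also have "\<dots> = ip (proj U v) u" using U finite_dec by simp
    also have "\<dots> = ip v u"
      using dec_proj_orth[OF U(1) v U(2)] ip_diff_left[OF v dec_proj_in_V[OF U(1) v] uV] by simp
    finally show "ip (v - ?s) u = 0" using ip_diff_left[OF v sV uV] by simp
  qed
  then show ?thesis by simp
qed

lemma intertwiner_restrict:
  assumes "invariant_subspace G \<rho> U" "intertwiner G \<rho> \<sigma> T"
  shows "intertwiner G (subrep \<rho> U) \<sigma> T"
  using invariantD(1)[OF assms(1)] intertwinerD[OF assms(2)]
  by (intro intertwinerI) (simp_all add: subset_iff)

lemma intertwiner_corestrict: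
  assumes "invariant_subspace G \<rho> U" "intertwiner G \<sigma> (subrep \<rho> U) T"
  shows "intertwiner G \<sigma> \<rho> T"
  using invariantD(1)[OF assms(1)] intertwinerD[OF assms(2)]
  by (intro intertwinerI) (auto simp: subset_iff)

text \<open>A standard copy of \<open>U\<close> is equivalent to both summands, which would give it
  multiplicity at least 2 if they differed.\<close>

lemma multiplicity_free_dec:
  assumes "multiplicity_free G \<rho>" "U \<in> dec" "U' \<in> dec" "equiv_rep G (subrep \<rho> U) (subrep \<rho> U')"
  shows "U = U'"
proof -
  obtain \<sigma> :: "'g std_rep" where s: "irreducible_rep G \<sigma>" "equiv_rep G \<sigma> (subrep \<rho> U)"
    using irreducible_std_copy_exists[OF is_group dec_irreducible[OF assms(2)]] by blast
  have s': "equiv_rep G \<sigma> (subrep \<rho> U')" by (rule equiv_rep_trans[OF s(2) assms(4)])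
  let ?M = "{W \<in> dec. equiv_rep G \<sigma> (subrep \<rho> W)}"
  have "Defs.multiplicity G \<sigma> \<rho> \<le> 1" using assms(1) s(1) unfolding multiplicity_free_def by blast
  then have "card ?M \<le> 1" unfolding Defs.multiplicity_def dec_def .
  moreover have fin: "finite ?M" using finite_dec by simp
  ultimately have eq: "\<forall>x\<in>?M. \<forall>y\<in>?M. x = y" unfolding One_nat_def card_le_Suc0_iff_eq[OF fin] by blast
  have "U \<in> ?M" "U' \<in> ?M" using assms(2,3) s(2) s' by simp_all
  then show ?thesis using eq by blast
qed

text \<open>By Schur's lemma the component of \<open>E\<close> from \<open>U\<close> to another
  summand is zero or an equivalence, and the latter is excluded. So \<open>E\<close> preserves
  \<open>U\<close> and is a scalar there.\<close>

lemma multiplicity_free_endo_scalar: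
  assumes mf: "multiplicity_free G \<rho>" and E: "intertwiner G \<rho> \<rho> E" and U: "U \<in> dec"
  shows "\<exists>c. \<forall>u\<in>U. E u = rep_scale \<rho> c u"
proof -
  note Ui = invariantD[OF dec_invariant[OF U]]
  have EU: "intertwiner G (subrep \<rho> U) \<rho> E" by (rule intertwiner_restrict[OF dec_invariant[OF U] E])
  have zero: "proj U' (E u) = 0" if U': "U' \<in> dec" "U' \<noteq> U" and u: "u \<in> U" for U' u
  proof -
    have "intertwiner G (subrep \<rho> U) (subrep \<rho> U') (\<lambda>v. proj U' (E v))"
      by (rule intertwiner_comp[OF EU intertwiner_proj[OF dec_invariant[OF U'(1)]]])
    moreover from this have "\<not> bij_betw (\<lambda>v. proj U' (E v)) U U'"
      using multiplicity_free_dec[OF mf U U'(1)] U'(2) unfolding equiv_rep_iff_intertwiner by auto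
    ultimately show ?thesis
      using schur_zero_or_bij[OF is_group dec_irreducible[OF U] dec_irreducible[OF U'(1)]] u by auto
  qed
  have EinU: "E u \<in> U" if u: "u \<in> U" for u
  proof -
    have EV: "E u \<in> V" using intertwinerD(1)[OF E] u Ui by blast
    have "(\<Sum>U'\<in>dec. proj U' (E u)) = (\<Sum>U'\<in>dec. if U' = U then proj U (E u) else 0)"
      using zero u by (intro sum.cong) auto
    then have "E u = proj U (E u)" using sum_proj_dec[OF EV] U finite_dec by simp
    then show ?thesis using dec_proj_in[OF U EV] by simp
  qed
  have "intertwiner G (subrep \<rho> U) (subrep \<rho> U) E"
    using intertwinerD[OF EU] EinU by (intro intertwinerI) simp_all
  then show ?thesis using schur_scalar[OF is_group dec_irreducible[OF U]] by fastforce
qed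

lemma multiplicity_free_endo_commute:
  assumes mf: "multiplicity_free G \<rho>" and E: "intertwiner G \<rho> \<rho> E" and F: "intertwiner G \<rho> \<rho> F"
    and v: "v \<in> V"
  shows "E (F v) = F (E v)"
proof -
  have additive: "T (\<Sum>U\<in>dec. proj U v) = (\<Sum>U\<in>dec. T (proj U v))" if T: "intertwiner G \<rho> \<rho> T" for T
    by (rule intertwiner_sum[OF urep_axioms urep_axioms T]) (rule dec_proj_in_V[OF _ v])
  have "E (F (proj U v)) = F (E (proj U v))" if U: "U \<in> dec" for U
  proof -
    have p: "proj U v \<in> U" "proj U v \<in> V" using dec_proj_in dec_proj_in_V U v by blast+
    obtain c d where "E (proj U v) = rep_scale \<rho> c (proj U v)" "F (proj U v) = rep_scale \<rho> d (proj U v)"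
      using multiplicity_free_endo_scalar[OF mf E U] multiplicity_free_endo_scalar[OF mf F U] p by blast
    then show ?thesis
      using intertwinerD(3)[OF E p(2)] intertwinerD(3)[OF F p(2)] by (simp add: mult.commute)
  qed
  then show ?thesis
    using additive[OF intertwiner_comp[OF E F]] additive[OF intertwiner_comp[OF F E]] sum_proj_dec[OF v]
    by simp
qed

text \<open>An equivalence \<open>R\<close> between two distinct summands \<open>U\<close> and
  \<open>U'\<close>, precomposed with the projection to \<open>U\<close>, is an endomorphism that
  fails to commute with this projection.\<close>

lemma multiplicity_free_if_endo_commute:
  assumes comm: "\<And>E F v. intertwiner G \<rho> \<rho> E \<Longrightarrow> intertwiner G \<rho> \<rho> F \<Longrightarrow> v \<in> V \<Longrightarrow> E (F v) = F (E v)"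
  shows "multiplicity_free G \<rho>"
  unfolding multiplicity_free_def Defs.multiplicity_def dec_def[symmetric]
proof (intro allI impI)
  fix \<sigma> :: "'g std_rep" assume \<sigma>: "irreducible_rep G \<sigma>"
  let ?M = "{W \<in> dec. equiv_rep G \<sigma> (subrep \<rho> W)}"
  have "U = U'" if U: "U \<in> ?M" and U': "U' \<in> ?M" for U U'
  proof (rule ccontr)
    assume ne: "U \<noteq> U'"
    have d: "U \<in> dec" "U' \<in> dec" using U U' by auto
    note Ui = invariantD[OF dec_invariant[OF d(1)]] and Ui' = invariantD[OF dec_invariant[OF d(2)]]
    have "equiv_rep G (subrep \<rho> U) \<sigma>"
      using U equiv_rep_sym[OF irreducible_urep[OF is_group \<sigma>] irreducible_urep[OF is_group dec_irreducible[OF d(1)]]]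
      by blast
    then have "equiv_rep G (subrep \<rho> U) (subrep \<rho> U')" using U' equiv_rep_trans by blast
    then obtain R where R: "intertwiner G (subrep \<rho> U) (subrep \<rho> U') R" "bij_betw R U U'"
      unfolding equiv_rep_iff_intertwiner by auto
    have p: "intertwiner G \<rho> (subrep \<rho> U) (proj U)" by (rule intertwiner_proj[OF dec_invariant[OF d(1)]])
    have E: "intertwiner G \<rho> \<rho> (\<lambda>v. R (proj U v))"
      by (rule intertwiner_corestrict[OF dec_invariant[OF d(2)] intertwiner_comp[OF p R(1)]])
    have F: "intertwiner G \<rho> \<rho> (proj U)"
      by (rule intertwiner_corestrict[OF dec_invariant[OF d(1)] p])
    have "R u = 0" if u: "u \<in> U" for u
    proof -
      have uV: "u \<in> V" using u Ui by blast
      have pu: "proj U u = u" by (rule proj_id[OF Ui(2,1) u])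
      have RU': "R u \<in> U'" using R(2) u unfolding bij_betw_def by blast
      then have RV: "R u \<in> V" using Ui' by blast
      \<comment> \<open>On \<open>u\<close> the product \<open>E F\<close> gives \<open>R u\<close>,
        while \<open>F E\<close> projects \<open>R u\<close>, a vector of the orthogonal summand
        \<open>U'\<close>, back to \<open>U\<close>.\<close>
      have "R u = proj U (R u)" using comm[OF E F uV] by (simp add: pu)
      also have "\<dots> = 0"
        using dec_orthogonal[OF d(2,1) ne[symmetric] RU'] subspace_0[OF Ui(2)]
        by (intro proj_eqI[OF Ui(2,1) RV]) auto
      finally show ?thesis .
    qed
    then have "R u = R 0" if "u \<in> U" for u using that subspace_0[OF Ui(2)] by simp
    then have "U = {0}" using R(2) subspace_0[OF Ui(2)] unfolding bij_betw_def inj_on_def by blast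
    then show False using dec_irreducible[OF d(1)] unfolding irreducible_rep_def by simp
  qed
  moreover have fin: "finite ?M" using finite_dec by simp
  ultimately show "card ?M \<le> 1" unfolding One_nat_def card_le_Suc0_iff_eq[OF fin] by blast
qed

end

section \<open>Induced representations\<close>

lemma sum_fun_apply: "(\<Sum>i\<in>I. f i) x = (\<Sum>i\<in>I. f i x)" for f :: "'i \<Rightarrow> 'a \<Rightarrow> 'b::comm_monoid_add"
  by (induction I rule: infinite_finite_induct) auto

text \<open>Instantiated at \<open>G\<close> and, through \<open>ind_K\<close>, also at the inertia
  group.\<close>

locale ind = group G for G :: "('g, 'b) monoid_scheme" (structure) +
  fixes N :: "'g set" and \<theta> :: "('g, 'v::ab_group_add) rep"
  assumes N: "subgroup N G" and fin: "finite (carrier G)"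
    and unitary_\<theta>: "unitary_rep (G\<lparr>carrier := N\<rparr>) \<theta>"
begin

abbreviation "GN \<equiv> G\<lparr>carrier := N\<rparr>"
abbreviation "W \<equiv> rep_space \<theta>"
abbreviation "\<theta>s \<equiv> rep_scale \<theta>"
abbreviation "\<theta>a \<equiv> rep_act \<theta>"

lemma group_GN: "group GN"
  using N by (rule subgroup.subgroup_is_group) (rule is_group)

lemma urep_\<theta>: "urep GN \<theta>"
  using group_GN unitary_\<theta> by (simp add: urep_def urep_axioms_def)

sublocale t: fd_inner \<theta>
  using unitary_\<theta> unfolding unitary_rep_def by unfold_locales blast

lemma N_in [simp]: "n \<in> N \<Longrightarrow> n \<in> carrier G" using subgroup.mem_carrier[OF N] .
lemma N_inv [simp]: "n \<in> N \<Longrightarrow> inv n \<in> N" using subgroup.m_inv_closed[OF N] .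
lemma N_mult [simp]: "n \<in> N \<Longrightarrow> m \<in> N \<Longrightarrow> n \<otimes> m \<in> N" using subgroup.m_closed[OF N] .
lemma N_one [simp]: "\<one> \<in> N" using subgroup.one_closed[OF N] .

lemma N_mult_iff: "g \<in> carrier G \<Longrightarrow> n \<in> N \<Longrightarrow> g \<otimes> n \<in> N \<longleftrightarrow> g \<in> N"
  by (metis N_in N_inv N_mult inv_closed m_assoc r_inv r_one)

lemma finite_N: "finite N" using fin N_in by (meson finite_subset subsetI)

lemma card_N: "card N \<noteq> 0" using finite_N N_one by (metis card_0_eq empty_iff)

lemmas W_zero = t.subspace_0[OF t.subspace_V]
lemmas W_add = t.subspace_add[OF t.subspace_V]
lemmas W_scale = t.subspace_scale[OF t.subspace_V]

lemma \<theta>_in [simp]: "n \<in> N \<Longrightarrow> v \<in> W \<Longrightarrow> \<theta>a n v \<in> W"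
  using urep.act_in[OF urep_\<theta>] by simp
lemma \<theta>_add: "n \<in> N \<Longrightarrow> u \<in> W \<Longrightarrow> v \<in> W \<Longrightarrow> \<theta>a n (u + v) = \<theta>a n u + \<theta>a n v"
  using urep.act_add[OF urep_\<theta>] by simp
lemma \<theta>_scale: "n \<in> N \<Longrightarrow> v \<in> W \<Longrightarrow> \<theta>a n (\<theta>s c v) = \<theta>s c (\<theta>a n v)"
  using urep.act_scale[OF urep_\<theta>] by simp
lemma \<theta>_zero: "n \<in> N \<Longrightarrow> \<theta>a n 0 = 0"
  using urep.act_zero[OF urep_\<theta>] by simp
lemma \<theta>_one: "v \<in> W \<Longrightarrow> \<theta>a \<one> v = v"
  using urep.act_one[OF urep_\<theta>] by simp
lemma \<theta>_mult: "n \<in> N \<Longrightarrow> m \<in> N \<Longrightarrow> v \<in> W \<Longrightarrow> \<theta>a (n \<otimes> m) v = \<theta>a n (\<theta>a m v)"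
  using urep.act_mult[OF urep_\<theta>] by simp
lemma \<theta>_inv: "n \<in> N \<Longrightarrow> v \<in> W \<Longrightarrow> \<theta>a (inv n) (\<theta>a n v) = v"
  using \<theta>_mult[of "inv n" n v] by (simp add: \<theta>_one)

section \<open>The space of the induced representation\<close>

abbreviation "\<I> \<equiv> induced_rep G N \<theta>"
abbreviation "H \<equiv> rep_space \<I>"

lemma H_iff: "f \<in> H \<longleftrightarrow> (\<forall>g\<in>carrier G. f g \<in> W) \<and> (\<forall>g. g \<notin> carrier G \<longrightarrow> f g = 0) \<and>
    (\<forall>g\<in>carrier G. \<forall>h\<in>N. f (g \<otimes> h) = \<theta>a (inv h) (f g))"
  by (simp add: induced_rep_def)

lemma HI:
  assumes "\<And>g. g \<in> carrier G \<Longrightarrow> f g \<in> W" "\<And>g. g \<notin> carrier G \<Longrightarrow> f g = 0"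
    "\<And>g h. g \<in> carrier G \<Longrightarrow> h \<in> N \<Longrightarrow> f (g \<otimes> h) = \<theta>a (inv h) (f g)"
  shows "f \<in> H"
  using assms unfolding H_iff by blast

lemma H_in: "f \<in> H \<Longrightarrow> g \<in> carrier G \<Longrightarrow> f g \<in> W"
  and H_out: "f \<in> H \<Longrightarrow> g \<notin> carrier G \<Longrightarrow> f g = 0"
  and H_cov: "f \<in> H \<Longrightarrow> g \<in> carrier G \<Longrightarrow> h \<in> N \<Longrightarrow> f (g \<otimes> h) = \<theta>a (inv h) (f g)"
  unfolding H_iff by blast+

lemma H_eqI:
  assumes "f \<in> H" "f' \<in> H" "\<And>g. g \<in> carrier G \<Longrightarrow> f g = f' g"
  shows "f = f'"
  using assms H_out by (metis ext)

lemma ind_scale [simp]: "rep_scale \<I> c f x = \<theta>s c (f x)"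
  by (simp add: induced_rep_def)

lemma ind_act: "rep_act \<I> g f x = (if x \<in> carrier G then f (inv g \<otimes> x) else 0)"
  by (simp add: induced_rep_def)

lemma ind_inner: "rep_inner \<I> f f' = (\<Sum>g\<in>carrier G. rep_inner \<theta> (f g) (f' g)) / of_nat (card N)"
  by (simp add: induced_rep_def)

lemma ind_vector_space: "vector_space (rep_scale \<I>)"
  by unfold_locales (auto simp: fun_eq_iff t.scale_right_distrib t.scale_left_distrib)

sublocale i: vector_space "rep_scale \<I>" by (rule ind_vector_space)

lemma subspace_H: "i.subspace H"
proof (rule i.subspaceI)
  show "0 \<in> H" by (rule HI) (simp_all add: W_zero \<theta>_zero)
  show "f + f' \<in> H" if "f \<in> H" "f' \<in> H" for f f'
    by (rule HI) (simp_all add: that W_add H_in H_out H_cov \<theta>_add)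
  show "rep_scale \<I> c f \<in> H" if "f \<in> H" for c f
    by (rule HI) (simp_all add: that W_scale H_in H_out H_cov \<theta>_scale)
qed

lemma ind_act_in:
  assumes g: "g \<in> carrier G" and f: "f \<in> H"
  shows "rep_act \<I> g f \<in> H"
  by (rule HI) (simp_all add: ind_act g f H_in H_cov m_assoc[symmetric])

section \<open>Generation by functions supported on the subgroup\<close>

text \<open>The element of the induced space that is supported on \<open>N\<close> and takes the
  value \<open>v\<close> at \<open>\<one>\<close>; by \<open>act_delta\<close> this embeds \<theta>
  into the restriction of the induced representation to \<open>N\<close>.\<close>

definition delta :: "'v \<Rightarrow> 'g \<Rightarrow> 'v" where
  "delta v g = (if g \<in> N then \<theta>a (inv g) v else 0)"

lemma delta_in_H: "v \<in> W \<Longrightarrow> delta v \<in> H"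
  by (rule HI) (auto simp: delta_def N_mult_iff W_zero \<theta>_zero inv_mult_group \<theta>_mult)

lemma delta_add: "u \<in> W \<Longrightarrow> v \<in> W \<Longrightarrow> delta (u + v) = delta u + delta v"
  by (auto simp: delta_def fun_eq_iff \<theta>_add)

lemma delta_scale: "v \<in> W \<Longrightarrow> delta (\<theta>s c v) = rep_scale \<I> c (delta v)"
  by (auto simp: delta_def fun_eq_iff \<theta>_scale)

lemma delta_zero: "delta 0 = 0"
  by (auto simp: delta_def fun_eq_iff \<theta>_zero)

lemma N_left_iff: "g \<in> carrier G \<Longrightarrow> n \<in> N \<Longrightarrow> n \<otimes> g \<in> N \<longleftrightarrow> g \<in> N"
  by (metis N_in N_inv N_mult inv_closed m_assoc l_inv l_one)

lemma act_delta: "n \<in> N \<Longrightarrow> v \<in> W \<Longrightarrow> rep_act \<I> n (delta v) = delta (\<theta>a n v)"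
  by (auto simp: delta_def fun_eq_iff ind_act N_left_iff inv_mult_group \<theta>_mult)

text \<open>The set is the left coset of \<open>x\<close>, parametrized by
  \<open>x \<otimes> inv n\<close>.\<close>

lemma fibre_card:
  assumes x: "x \<in> carrier G"
  shows "card {h \<in> carrier G. inv h \<otimes> x \<in> N} = card N"
proof -
  have "bij_betw (\<lambda>n. x \<otimes> inv n) N {h \<in> carrier G. inv h \<otimes> x \<in> N}"
    by (rule bij_betwI[where g = "\<lambda>h. inv h \<otimes> x"])
      (auto simp: x inv_mult_group m_assoc, simp add: x m_assoc[symmetric])
  then show ?thesis using bij_betw_same_card by fastforce
qed

text \<open>At \<open>x\<close> only the \<open>h\<close> in the coset of \<open>x\<close>
  contribute, and by covariance each contributes \<open>f x\<close>. Averaging over all of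
  \<open>G\<close> avoids choosing coset representatives.\<close>

lemma reconstruct:
  assumes f: "f \<in> H"
  shows "rep_scale \<I> (1 / of_nat (card N)) (\<Sum>h\<in>carrier G. rep_act \<I> h (delta (f h))) = f"
proof
  fix x
  show "rep_scale \<I> (1 / of_nat (card N)) (\<Sum>h\<in>carrier G. rep_act \<I> h (delta (f h))) x = f x"
  proof (cases "x \<in> carrier G")
    case False
    then show ?thesis using H_out[OF f] by (simp add: sum_fun_apply ind_act)
  next
    case x: True
    have "delta (f h) (inv h \<otimes> x) = (if inv h \<otimes> x \<in> N then f x else 0)" if h: "h \<in> carrier G" for h
    proof (cases "inv h \<otimes> x \<in> N")
      case True
      have "f x = f (h \<otimes> (inv h \<otimes> x))" using h x by (simp add: m_assoc[symmetric])
      also have "\<dots> = \<theta>a (inv (inv h \<otimes> x)) (f h)" by (rule H_cov[OF f h True])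
      finally show ?thesis using True by (simp add: delta_def)
    qed (simp add: delta_def)
    then have "(\<Sum>h\<in>carrier G. rep_act \<I> h (delta (f h))) x =
        (\<Sum>h\<in>carrier G. if inv h \<otimes> x \<in> N then f x else 0)"
      by (simp add: sum_fun_apply ind_act x)
    also have "\<dots> = (\<Sum>h\<in>{h \<in> carrier G. inv h \<otimes> x \<in> N}. f x)"
      using fin by (simp add: sum.inter_filter)
    also have "\<dots> = \<theta>s (of_nat (card N)) (f x)"
      by (simp only: t.sum_constant_scale fibre_card[OF x])
    finally show ?thesis using card_N by simp
  qed
qed

text \<open>By \<open>reconstruct\<close> the translates of all \<open>delta v\<close> generate, and
  by linearity in \<open>v\<close> it is enough to let \<open>v\<close> run through a finite
  generating set of \<open>W\<close>.\<close>

lemma H_finite_span: "\<exists>B. finite B \<and> H = i.span B"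
proof -
  obtain B where B: "finite B" "W = t.span B" using t.finite_span_V by blast
  have BW: "B \<subseteq> W" unfolding B by (rule t.span_superset)
  define C where "C = (\<lambda>(h, b). rep_act \<I> h (delta b)) ` (carrier G \<times> B)"
  have "rep_act \<I> h (delta v) \<in> i.span C" if h: "h \<in> carrier G" and v: "v \<in> W" for h v
  proof -
    have a: "rep_act \<I> h (f + f') = rep_act \<I> h f + rep_act \<I> h f'"
      "rep_act \<I> h (rep_scale \<I> c f) = rep_scale \<I> c (rep_act \<I> h f)" "rep_act \<I> h 0 = 0" for f f' c
      by (auto simp: fun_eq_iff ind_act)
    have "t.subspace {v \<in> W. rep_act \<I> h (delta v) \<in> i.span C}"
      by (intro t.subspaceI)
        (auto simp: W_zero W_add W_scale delta_zero delta_add delta_scale a i.span_zero i.span_add i.span_scale)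
    moreover have "B \<subseteq> {v \<in> W. rep_act \<I> h (delta v) \<in> i.span C}"
      using BW h by (auto simp: C_def intro!: i.span_base)
    ultimately have "t.span B \<subseteq> {v \<in> W. rep_act \<I> h (delta v) \<in> i.span C}"
      by (intro t.span_minimal)
    then show ?thesis using v B by blast
  qed
  then have "rep_scale \<I> (1 / of_nat (card N)) (\<Sum>h\<in>carrier G. rep_act \<I> h (delta (f h))) \<in> i.span C"
    if "f \<in> H" for f using H_in[OF that] by (intro i.span_scale i.span_sum) blast
  then have "f \<in> i.span C" if "f \<in> H" for f using reconstruct[OF that] that by metis
  moreover have "i.span C \<subseteq> H"
    using BW by (intro i.span_minimal subspace_H) (auto simp: C_def intro!: ind_act_in delta_in_H)
  moreover have "finite C" using B fin by (simp add: C_def)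
  ultimately show ?thesis by blast
qed

section \<open>Unitarity, and endomorphisms as convolutions\<close>

lemma unitary_ind: "unitary_rep G \<I>"
proof -
  have "fin_dim_inner_space \<I>"
    unfolding fin_dim_inner_space_def
  proof (intro conjI ballI allI impI)
    show "vector_space (rep_scale \<I>)" by (rule ind_vector_space)
    show "\<exists>B. finite B \<and> H = i.span B" by (rule H_finite_span)
  next
    fix u v w assume "u \<in> H" "v \<in> H" "w \<in> H"
    then show "rep_inner \<I> (u + v) w = rep_inner \<I> u w + rep_inner \<I> v w"
      by (simp add: ind_inner add_divide_distrib[symmetric] sum.distrib[symmetric] t.ip_add_left H_in)
  next
    fix c u v assume "u \<in> H" "v \<in> H"
    then show "rep_inner \<I> (rep_scale \<I> c u) v = c * rep_inner \<I> u v"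
      by (simp add: ind_inner sum_distrib_left t.ip_scale_left H_in)
  next
    fix u v assume uv: "u \<in> H" "v \<in> H"
    have "rep_inner \<theta> (v g) (u g) = cnj (rep_inner \<theta> (u g) (v g))" if "g \<in> carrier G" for g
      using uv that by (intro t.ip_cnj H_in)
    then have "(\<Sum>g\<in>carrier G. rep_inner \<theta> (v g) (u g)) =
        (\<Sum>g\<in>carrier G. cnj (rep_inner \<theta> (u g) (v g)))"
      by (intro sum.cong refl)
    then show "rep_inner \<I> v u = cnj (rep_inner \<I> u v)"
      by (simp only: ind_inner complex_cnj_divide cnj_sum complex_cnj_of_nat)
  next
    fix u assume u: "u \<in> H" "u \<noteq> 0"
    then obtain x where x: "u x \<noteq> 0" by (auto simp: fun_eq_iff)
    then have xG: "x \<in> carrier G" using H_out u by blast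
    have "0 < (\<Sum>g\<in>carrier G. Re (rep_inner \<theta> (u g) (u g)))"
    proof (rule sum_pos2[OF fin xG])
      show "0 < Re (rep_inner \<theta> (u x) (u x))" by (rule t.ip_pos[OF H_in[OF u(1) xG] x])
      fix g assume g: "g \<in> carrier G"
      show "0 \<le> Re (rep_inner \<theta> (u g) (u g))"
        using t.ip_pos[OF H_in[OF u(1) g]] t.ip_zero_left[OF W_zero] by (cases "u g = 0") auto
    qed
    \<comment> \<open>The denominator is written as a real number so that the real part passes
      through the quotient.\<close>
    moreover have "rep_inner \<I> u u = (\<Sum>g\<in>carrier G. rep_inner \<theta> (u g) (u g)) / complex_of_real (of_nat (card N))"
      by (simp add: ind_inner)
    ultimately show "0 < Re (rep_inner \<I> u u)"
      using card_N by (simp only: Re_divide_of_real Re_sum) simp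
  qed
  moreover have "linear_between \<I> \<I> (rep_act \<I> g)" if "g \<in> carrier G" for g
    unfolding linear_between_def using that by (auto simp: ind_act_in) (auto simp: ind_act fun_eq_iff)
  moreover have "rep_act \<I> \<one> f = f" if "f \<in> H" for f
    using H_out[OF that] by (auto simp: ind_act fun_eq_iff)
  moreover have "rep_act \<I> (g \<otimes> h) f = rep_act \<I> g (rep_act \<I> h f)"
    if "g \<in> carrier G" "h \<in> carrier G" for g h f
    using that by (auto simp: ind_act fun_eq_iff inv_mult_group m_assoc)
  moreover have "rep_inner \<I> (rep_act \<I> g u) (rep_act \<I> g v) = rep_inner \<I> u v"
    if g: "g \<in> carrier G" for g u v
  proof -
    have "(\<Sum>x\<in>carrier G. rep_inner \<theta> (u (inv g \<otimes> x)) (v (inv g \<otimes> x))) =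
        (\<Sum>x\<in>carrier G. rep_inner \<theta> (u x) (v x))"
      by (rule sum.reindex_bij_witness[of _ "\<lambda>x. g \<otimes> x" "\<lambda>x. inv g \<otimes> x"])
        (use g in \<open>simp_all add: m_assoc[symmetric]\<close>)
    then show ?thesis by (simp add: ind_inner ind_act)
  qed
  ultimately show ?thesis unfolding unitary_rep_def by simp
qed

lemma urep_ind: "urep G \<I>"
  using unitary_ind is_group by (simp add: urep_def urep_axioms_def)

text \<open>The translates of the functions \<^term>\<open>delta v\<close> span the induced space, so an endomorphism is
  determined by its values on them.\<close>

lemma endo_convolution:
  assumes E: "intertwiner G \<I> \<I> E" and f: "f \<in> H" and g: "g \<in> carrier G"
  shows "E f g = \<theta>s (1 / of_nat (card N)) (\<Sum>x\<in>carrier G. E (delta (f (g \<otimes> x))) (inv x))"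
proof -
  have dH: "rep_act \<I> h (delta (f h)) \<in> H" if "h \<in> carrier G" for h
    using that by (intro ind_act_in delta_in_H H_in[OF f])
  have sH: "(\<Sum>h\<in>carrier G. rep_act \<I> h (delta (f h))) \<in> H"
    using dH by (intro i.subspace_sum[OF subspace_H])
  have "E f = E (rep_scale \<I> (1 / of_nat (card N)) (\<Sum>h\<in>carrier G. rep_act \<I> h (delta (f h))))"
    by (simp only: reconstruct[OF f])
  also have "\<dots> = rep_scale \<I> (1 / of_nat (card N)) (\<Sum>h\<in>carrier G. E (rep_act \<I> h (delta (f h))))"
    by (simp only: intertwinerD(3)[OF E sH] intertwiner_sum[OF urep_ind urep_ind E dH])
  also have "(\<Sum>h\<in>carrier G. E (rep_act \<I> h (delta (f h)))) = (\<Sum>h\<in>carrier G. rep_act \<I> h (E (delta (f h))))"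
    by (intro sum.cong refl intertwinerD(4)[OF E] delta_in_H H_in[OF f])
  finally have "E f g = \<theta>s (1 / of_nat (card N)) (\<Sum>h\<in>carrier G. E (delta (f h)) (inv h \<otimes> g))"
    by (simp add: sum_fun_apply ind_act g)
  \<comment> \<open>Substituting \<open>h = g \<otimes> x\<close> makes the point of evaluation
    independent of \<open>g\<close>.\<close>
  also have "(\<Sum>h\<in>carrier G. E (delta (f h)) (inv h \<otimes> g)) =
      (\<Sum>x\<in>carrier G. E (delta (f (g \<otimes> x))) (inv x))"
    by (rule sum.reindex_bij_witness[of _ "\<lambda>x. g \<otimes> x" "\<lambda>h. inv g \<otimes> h"])
      (use g in \<open>simp_all add: m_assoc[symmetric] inv_mult_group\<close>)
  finally show ?thesis .
qed

end

section \<open>The inertia group\<close>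

lemma res_rep_simps [simp]:
  "rep_space (res_rep H \<rho>) = rep_space \<rho>" "rep_scale (res_rep H \<rho>) = rep_scale \<rho>"
  "rep_inner (res_rep H \<rho>) = rep_inner \<rho>" "h \<in> H \<Longrightarrow> rep_act (res_rep H \<rho>) h = rep_act \<rho> h"
  by (simp_all add: res_rep_def)

lemma conj_rep_simps [simp]:
  "rep_space (conj_rep G x \<rho>) = rep_space \<rho>" "rep_scale (conj_rep G x \<rho>) = rep_scale \<rho>"
  "rep_inner (conj_rep G x \<rho>) = rep_inner \<rho>"
  "rep_act (conj_rep G x \<rho>) n = rep_act \<rho> (inv\<^bsub>G\<^esub> x \<otimes>\<^bsub>G\<^esub> n \<otimes>\<^bsub>G\<^esub> x)"
  by (simp_all add: conj_rep_def)

text \<open>Used twice: with conjugation by \<open>x\<close> for the conjugates of \<theta>, and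
  with the identity for restriction to \<open>N\<close>.\<close>

lemma (in group) unitary_rep_pullback:
  assumes "unitary_rep K \<rho>" "group K"
    and "rep_space \<sigma> = rep_space \<rho>" "rep_scale \<sigma> = rep_scale \<rho>" "rep_inner \<sigma> = rep_inner \<rho>"
    and phi: "\<And>g. g \<in> carrier G \<Longrightarrow> \<phi> g \<in> carrier K" "\<phi> \<one> = \<one>\<^bsub>K\<^esub>"
      "\<And>g h. g \<in> carrier G \<Longrightarrow> h \<in> carrier G \<Longrightarrow> \<phi> (g \<otimes> h) = \<phi> g \<otimes>\<^bsub>K\<^esub> \<phi> h"
      "\<And>g v. g \<in> carrier G \<Longrightarrow> v \<in> rep_space \<rho> \<Longrightarrow> rep_act \<sigma> g v = rep_act \<rho> (\<phi> g) v"
  shows "unitary_rep G \<sigma>"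
proof -
  interpret r: urep K \<rho> using assms by (simp add: urep_def urep_axioms_def)
  have "fin_dim_inner_space \<sigma> = fin_dim_inner_space \<rho>"
    by (simp only: fin_dim_inner_space_def assms(3-5))
  then have "fin_dim_inner_space \<sigma>" using r.fd by simp
  moreover have "linear_between \<sigma> \<sigma> (rep_act \<sigma> g)" if "g \<in> carrier G" for g
    unfolding linear_between_def using that assms(3-5)
    by (auto simp: phi r.act_in r.act_add r.act_scale r.subspace_add[OF r.subspace_V]
        r.subspace_scale[OF r.subspace_V])
  ultimately show ?thesis
    unfolding unitary_rep_def by (simp add: assms(3-5) phi r.act_in r.act_one r.act_mult r.act_inner)
qed

locale irr_ind = ind +
  assumes normal: "N \<lhd> G" and irr: "irreducible_rep GN \<theta>"
begin

section \<open>Conjugates of the inducing representation\<close>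

lemma mult_inv_cancel:
  "x \<in> carrier G \<Longrightarrow> y \<in> carrier G \<Longrightarrow> x \<otimes> (inv x \<otimes> y) = y"
  "x \<in> carrier G \<Longrightarrow> y \<in> carrier G \<Longrightarrow> inv x \<otimes> (x \<otimes> y) = y"
  by (simp_all add: m_assoc[symmetric])

lemma conj_N: "x \<in> carrier G \<Longrightarrow> n \<in> N \<Longrightarrow> inv x \<otimes> n \<otimes> x \<in> N"
  using normal.inv_op_closed1[OF normal] .

lemma conj_N': "x \<in> carrier G \<Longrightarrow> n \<in> N \<Longrightarrow> x \<otimes> n \<otimes> inv x \<in> N"
  using normal.inv_op_closed2[OF normal] .

text \<open>Conjugation by \<open>x\<close> permutes \<open>N\<close>, so the conjugate is given by
  the same operators in a different order and has the same invariant subspaces.\<close>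

lemma conj_irreducible:
  assumes x: "x \<in> carrier G"
  shows "irreducible_rep GN (conj_rep G x \<theta>)"
proof -
  have uni: "unitary_rep GN (conj_rep G x \<theta>)"
    by (rule group.unitary_rep_pullback[OF group_GN unitary_\<theta> group_GN, where \<phi> = "\<lambda>n. inv x \<otimes> n \<otimes> x"])
      (use x conj_N in \<open>simp_all add: m_assoc mult_inv_cancel\<close>)
  have "invariant_subspace GN \<theta> U" if U: "invariant_subspace GN (conj_rep G x \<theta>) U" for U
  proof -
    have "\<theta>a n u \<in> U" if n: "n \<in> N" and u: "u \<in> U" for n u
    proof -
      have "inv x \<otimes> (x \<otimes> n \<otimes> inv x) \<otimes> x = n" using x n by (simp add: m_assoc mult_inv_cancel)
      moreover have "rep_act (conj_rep G x \<theta>) (x \<otimes> n \<otimes> inv x) u \<in> U"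
        using U conj_N'[OF x n] u unfolding invariant_subspace_def by simp
      ultimately show ?thesis by simp
    qed
    then show ?thesis using U unfolding invariant_subspace_def by simp
  qed
  then show ?thesis using uni irr unfolding irreducible_rep_def by simp
qed

abbreviation tw :: "'a \<Rightarrow> ('c \<Rightarrow> 'c) \<Rightarrow> bool" where
  "tw x T \<equiv> intertwiner GN (conj_rep G x \<theta>) \<theta> T"

lemma twD:
  assumes "tw x T" "v \<in> W"
  shows tw_in: "T v \<in> W" and tw_add: "u \<in> W \<Longrightarrow> T (u + v) = T u + T v"
    and tw_scale: "T (\<theta>s c v) = \<theta>s c (T v)"
    and tw_act: "n \<in> N \<Longrightarrow> T (\<theta>a (inv x \<otimes> n \<otimes> x) v) = \<theta>a n (T v)"
  using intertwinerD[OF assms(1)] assms(2) by simp_all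

lemma tw_zero: "tw x T \<Longrightarrow> T 0 = 0"
  using tw_scale[of x T 0 0] W_zero by simp

lemma twI:
  assumes "\<And>v. v \<in> W \<Longrightarrow> T v \<in> W" "\<And>u v. u \<in> W \<Longrightarrow> v \<in> W \<Longrightarrow> T (u + v) = T u + T v"
    "\<And>c v. v \<in> W \<Longrightarrow> T (\<theta>s c v) = \<theta>s c (T v)"
    "\<And>n v. n \<in> N \<Longrightarrow> v \<in> W \<Longrightarrow> T (\<theta>a (inv x \<otimes> n \<otimes> x) v) = \<theta>a n (T v)"
  shows "tw x T"
  by (rule intertwinerI) (use assms in simp_all)

section \<open>The inertia group and its intertwiners\<close>

definition I :: "'a set" where
  "I = inertia_group G N \<theta>"

lemma mem_I: "x \<in> I \<longleftrightarrow> x \<in> carrier G \<and> (\<exists>T. tw x T \<and> bij_betw T W W)"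
  unfolding I_def inertia_group_def by (simp add: equiv_rep_iff_intertwiner)

text \<open>For \<open>x\<close> in \<open>N\<close> the operator \<open>\<theta>a x\<close> itself
  is the required intertwiner.\<close>

lemma N_subset_I: "N \<subseteq> I"
proof
  fix x assume x: "x \<in> N"
  have "\<theta>a x (\<theta>a (inv x \<otimes> n \<otimes> x) v) = \<theta>a n (\<theta>a x v)" if "n \<in> N" "v \<in> W" for n v
    using that x by (simp add: \<theta>_mult[symmetric] m_assoc[symmetric])
  then have "tw x (\<theta>a x)" using x by (intro twI) (simp_all add: \<theta>_add \<theta>_scale)
  moreover have "bij_betw (\<theta>a x) W W"
    by (rule bij_betwI[where g = "\<theta>a (inv x)"])
      (use x \<theta>_inv[OF x] \<theta>_inv[OF N_inv[OF x]] in auto)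
  ultimately show "x \<in> I" using x mem_I by auto
qed

text \<open>The inverse of an intertwiner for \<open>x\<close> is one for \<open>inv x\<close>, and
  composing intertwiners for \<open>x\<close> and \<open>y\<close> gives one for
  \<open>x \<otimes> y\<close>.\<close>

lemma subgroup_I: "subgroup I G"
proof (rule subgroupI)
  show "I \<subseteq> carrier G" using mem_I by blast
  show "I \<noteq> {}" using N_subset_I N_one by blast
next
  fix x assume "x \<in> I"
  then obtain T where x: "x \<in> carrier G" and T: "tw x T" and b: "bij_betw T W W" using mem_I by blast
  let ?S = "the_inv_into W T"
  have inj: "inj_on T W" and im: "T ` W = W" using b unfolding bij_betw_def by blast+
  have S: "?S w \<in> W" "T (?S w) = w" if "w \<in> W" for w
    using that inj im the_inv_into_into[OF inj, of w W] f_the_inv_into_f[OF inj] by auto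
  have "?S (\<theta>a (inv (inv x) \<otimes> n \<otimes> inv x) w) = \<theta>a n (?S w)" if n: "n \<in> N" and w: "w \<in> W" for n w
  proof (rule the_inv_into_f_eq[OF inj])
    have "\<theta>a (x \<otimes> n \<otimes> inv x) (T (?S w)) = T (\<theta>a (inv x \<otimes> (x \<otimes> n \<otimes> inv x) \<otimes> x) (?S w))"
      using tw_act[OF T S(1)[OF w] conj_N'[OF x n]] by simp
    also have "inv x \<otimes> (x \<otimes> n \<otimes> inv x) \<otimes> x = n" using x n by (simp add: m_assoc mult_inv_cancel)
    finally show "T (\<theta>a n (?S w)) = \<theta>a (inv (inv x) \<otimes> n \<otimes> inv x) w" using S(2)[OF w] x by simp
  qed (use n S(1)[OF w] in simp)
  then have "tw (inv x) ?S"
    by (intro twI) (simp_all add: the_inv_into_f_eq[OF inj] S W_add W_scale tw_add[OF T] tw_scale[OF T])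
  then show "inv x \<in> I" using mem_I x bij_betw_the_inv_into[OF b] by blast
next
  fix x y assume "x \<in> I" "y \<in> I"
  then obtain S T where x: "x \<in> carrier G" and S: "tw x S" "bij_betw S W W"
    and y: "y \<in> carrier G" and T: "tw y T" "bij_betw T W W" using mem_I by blast
  have "S (T (\<theta>a (inv (x \<otimes> y) \<otimes> n \<otimes> (x \<otimes> y)) v)) = \<theta>a n (S (T v))" if n: "n \<in> N" and v: "v \<in> W" for n v
  proof -
    have "inv (x \<otimes> y) \<otimes> n \<otimes> (x \<otimes> y) = inv y \<otimes> (inv x \<otimes> n \<otimes> x) \<otimes> y"
      using x y n by (simp add: inv_mult_group m_assoc)
    then show ?thesis using tw_act[OF T(1) v conj_N[OF x n]] tw_act[OF S(1) tw_in[OF T(1) v] n] by simp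
  qed
  then have "tw (x \<otimes> y) (\<lambda>v. S (T v))"
    by (intro twI) (simp_all add: tw_in[OF T(1)] tw_add[OF T(1)] tw_scale[OF T(1)]
        tw_in[OF S(1)] tw_add[OF S(1)] tw_scale[OF S(1)])
  then show "x \<otimes> y \<in> I"
    using mem_I x y bij_betw_trans[OF T(2) S(2)] by (auto simp: comp_def)
qed

lemma I_in: "x \<in> I \<Longrightarrow> x \<in> carrier G" using mem_I by blast

section \<open>Endomorphisms of the induced representation\<close>

text \<open>Right translation by \<open>x\<close> alone turns covariance under \<theta> into
  covariance under its conjugate; applying \<open>T\<close> corrects this.\<close>

definition L :: "'a \<Rightarrow> ('c \<Rightarrow> 'c) \<Rightarrow> ('a \<Rightarrow> 'c) \<Rightarrow> 'a \<Rightarrow> 'c" where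
  "L x T f g = (if g \<in> carrier G then T (f (g \<otimes> x)) else 0)"

text \<open>Left and right translations commute, which gives equivariance. For covariance,
  \<open>h\<close> is moved past \<open>x\<close> by normality, becoming
  \<open>inv x \<otimes> h \<otimes> x\<close>, and \<open>T\<close> turns the action of that
  element into the action of \<open>h\<close>.\<close>

lemma L_intertwiner:
  assumes x: "x \<in> carrier G" and T: "tw x T"
  shows "intertwiner G \<I> \<I> (L x T)"
proof (rule intertwinerI)
  fix f assume f: "f \<in> H"
  show "L x T f \<in> H"
  proof (rule HI)
    fix g h assume g: "g \<in> carrier G" and h: "h \<in> N"
    have e: "g \<otimes> h \<otimes> x = (g \<otimes> x) \<otimes> (inv x \<otimes> h \<otimes> x)"
      using g h x by (simp add: m_assoc mult_inv_cancel)
    have "f (g \<otimes> h \<otimes> x) = \<theta>a (inv (inv x \<otimes> h \<otimes> x)) (f (g \<otimes> x))"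
      unfolding e using g x conj_N[OF x h] by (intro H_cov[OF f]) simp_all
    also have "inv (inv x \<otimes> h \<otimes> x) = inv x \<otimes> inv h \<otimes> x" using x h by (simp add: inv_mult_group m_assoc)
    finally have "T (f (g \<otimes> h \<otimes> x)) = \<theta>a (inv h) (T (f (g \<otimes> x)))"
      using tw_act[OF T H_in[OF f, of "g \<otimes> x"] N_inv[OF h]] g x by simp
    then show "L x T f (g \<otimes> h) = \<theta>a (inv h) (L x T f g)" using g h by (simp add: L_def)
  qed (use x tw_in[OF T H_in[OF f]] in \<open>simp_all add: L_def\<close>)
next
  fix f f' assume "f \<in> H" "f' \<in> H"
  then show "L x T (f + f') = L x T f + L x T f'"
    using x by (auto simp: fun_eq_iff L_def tw_add[OF T] H_in)
next
  fix c f assume "f \<in> H"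
  then show "L x T (rep_scale \<I> c f) = rep_scale \<I> c (L x T f)"
    using x by (auto simp: fun_eq_iff L_def tw_scale[OF T] H_in)
next
  fix g f assume "g \<in> carrier G" "f \<in> H"
  then show "L x T (rep_act \<I> g f) = rep_act \<I> g (L x T f)"
    using x by (auto simp: fun_eq_iff L_def ind_act m_assoc)
qed

text \<open>This is the value at \<open>x\<close> of the kernel in \<open>endo_convolution\<close>.
  Acting by \<open>inv x \<otimes> n \<otimes> x\<close> on \<open>delta v\<close> moves the point
  of evaluation to \<open>inv x \<otimes> inv n\<close>, and covariance then produces the action of
  \<open>n\<close>.\<close>

lemma endo_kernel_tw:
  assumes E: "intertwiner G \<I> \<I> E" and x: "x \<in> carrier G"
  shows "tw x (\<lambda>v. E (delta v) (inv x))"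
proof (rule twI)
  fix v assume v: "v \<in> W"
  have Ed: "E (delta v) \<in> H" by (rule intertwinerD(1)[OF E delta_in_H[OF v]])
  show "E (delta v) (inv x) \<in> W" using x by (intro H_in[OF Ed]) simp
  show "E (delta (u + v)) (inv x) = E (delta u) (inv x) + E (delta v) (inv x)" if "u \<in> W" for u
    using intertwinerD(2)[OF E delta_in_H[OF that] delta_in_H[OF v]] delta_add[OF that v] by simp
  show "E (delta (\<theta>s c v)) (inv x) = \<theta>s c (E (delta v) (inv x))" for c
    using intertwinerD(3)[OF E delta_in_H[OF v]] delta_scale[OF v] by simp
  fix n assume n: "n \<in> N"
  let ?m = "inv x \<otimes> n \<otimes> x"
  have m: "?m \<in> N" by (rule conj_N[OF x n])
  have "E (delta (\<theta>a ?m v)) (inv x) = rep_act \<I> ?m (E (delta v)) (inv x)"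
    using intertwinerD(4)[OF E N_in[OF m] delta_in_H[OF v]] by (simp add: act_delta[OF m v])
  also have "\<dots> = E (delta v) (inv x \<otimes> inv n)"
    using x n by (simp add: ind_act inv_mult_group m_assoc)
  also have "\<dots> = \<theta>a n (E (delta v) (inv x))" using H_cov[OF Ed, of "inv x" "inv n"] x n by simp
  finally show "E (delta (\<theta>a ?m v)) (inv x) = \<theta>a n (E (delta v) (inv x))" .
qed

section \<open>The inertia group as a group, and its quotient\<close>

abbreviation "K \<equiv> G\<lparr>carrier := I\<rparr>"

lemma group_K: "group K"
  using subgroup_I by (rule subgroup.subgroup_is_group) (rule is_group)

lemma normal_K: "N \<lhd> K"
  by (rule normal_restrict_supergroup[OF subgroup_I normal N_subset_I])

lemma inv_K: "x \<in> I \<Longrightarrow> inv\<^bsub>K\<^esub> x = inv x"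
  by (rule m_inv_consistent[OF subgroup_I])

lemma ind_K: "ind K N \<theta>"
proof -
  have "subgroup N K" using normal_K by (simp add: normal_imp_subgroup)
  moreover have "finite I" using fin I_in by (meson finite_subset subsetI)
  ultimately show ?thesis using group_K unitary_\<theta> by (simp add: ind_def ind_axioms_def)
qed

text \<open>Replaces the quotient by an elementwise condition, in which both directions of the
  theorem meet it: \<open>y \<otimes> x\<close> lies in the left coset of
  \<open>x \<otimes> y\<close>.\<close>

lemma abelian_quotient_iff:
  "comm_group (K Mod N) \<longleftrightarrow> (\<forall>x\<in>I. \<forall>y\<in>I. inv (x \<otimes> y) \<otimes> (y \<otimes> x) \<in> N)"
proof -
  interpret k: normal N K by (rule normal_K)
  have eq: "N #>\<^bsub>K\<^esub> (x \<otimes> y) = N #>\<^bsub>K\<^esub> (y \<otimes> x) \<longleftrightarrow> inv (x \<otimes> y) \<otimes> (y \<otimes> x) \<in> N"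
    if xy: "x \<in> I" "y \<in> I" for x y
  proof -
    have c: "x \<in> carrier G" "y \<in> carrier G" using xy I_in by auto
    have cK: "x \<otimes> y \<in> I" "y \<otimes> x \<in> I" using xy subgroup.m_closed[OF subgroup_I] by auto
    have "N #>\<^bsub>K\<^esub> (x \<otimes> y) = N #>\<^bsub>K\<^esub> (y \<otimes> x) \<longleftrightarrow> y \<otimes> x \<in> N #>\<^bsub>K\<^esub> (x \<otimes> y)"
      using k.repr_independence[of "y \<otimes> x" N "x \<otimes> y"] k.rcos_self[of "y \<otimes> x" N] cK k.subgroup_axioms
      by auto
    also have "\<dots> \<longleftrightarrow> y \<otimes> x \<in> (x \<otimes> y) <#\<^bsub>K\<^esub> N" using k.coset_eq cK by simp
    also have "\<dots> \<longleftrightarrow> inv (x \<otimes> y) \<otimes> (y \<otimes> x) \<in> N"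
    proof
      assume "y \<otimes> x \<in> (x \<otimes> y) <#\<^bsub>K\<^esub> N"
      then obtain n where n: "n \<in> N" "y \<otimes> x = (x \<otimes> y) \<otimes> n" by (auto simp: l_coset_def)
      have "inv (x \<otimes> y) \<otimes> ((x \<otimes> y) \<otimes> n) = n" using n c by (intro mult_inv_cancel) simp_all
      then show "inv (x \<otimes> y) \<otimes> (y \<otimes> x) \<in> N" using n by simp
    next
      assume "inv (x \<otimes> y) \<otimes> (y \<otimes> x) \<in> N"
      moreover have "y \<otimes> x = (x \<otimes> y) \<otimes> (inv (x \<otimes> y) \<otimes> (y \<otimes> x))"
        using c by (simp add: m_assoc[symmetric])
      ultimately show "y \<otimes> x \<in> (x \<otimes> y) <#\<^bsub>K\<^esub> N" unfolding l_coset_def by auto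
    qed
    finally show ?thesis .
  qed
  have sum: "(N #>\<^bsub>K\<^esub> x) \<otimes>\<^bsub>K Mod N\<^esub> (N #>\<^bsub>K\<^esub> y) = N #>\<^bsub>K\<^esub> (x \<otimes> y)" if "x \<in> I" "y \<in> I" for x y
    using k.rcos_sum[of x y] that by (simp add: FactGroup_def)
  have car: "carrier (K Mod N) = (\<lambda>x. N #>\<^bsub>K\<^esub> x) ` I" by (auto simp: FactGroup_def RCOSETS_def)
  show ?thesis
  proof
    assume c: "comm_group (K Mod N)"
    show "\<forall>x\<in>I. \<forall>y\<in>I. inv (x \<otimes> y) \<otimes> (y \<otimes> x) \<in> N"
    proof (intro ballI)
      fix x y assume xy: "x \<in> I" "y \<in> I"
      have "N #>\<^bsub>K\<^esub> (x \<otimes> y) = N #>\<^bsub>K\<^esub> (y \<otimes> x)"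
        unfolding sum[OF xy, symmetric] sum[OF xy(2,1), symmetric]
        by (rule comm_groupE(4)[OF c]) (use xy in \<open>simp_all add: car\<close>)
      then show "inv (x \<otimes> y) \<otimes> (y \<otimes> x) \<in> N" using eq xy by blast
    qed
  next
    assume a: "\<forall>x\<in>I. \<forall>y\<in>I. inv (x \<otimes> y) \<otimes> (y \<otimes> x) \<in> N"
    show "comm_group (K Mod N)"
      by (rule group.group_comm_groupI[OF k.factorgroup_is_group])
        (use a eq sum in \<open>auto simp: car\<close>)
  qed
qed

section \<open>Necessity of the two conditions\<close>

lemma W_nonzero: "\<exists>v\<in>W. v \<noteq> 0"
  using irr W_zero unfolding irreducible_rep_def by blast

lemma bij_tw_eq_0:
  assumes "tw x T" "bij_betw T W W" "v \<in> W" "T v = 0"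
  shows "v = 0"
  using assms tw_zero[OF assms(1)] W_zero inj_onD[OF bij_betw_imp_inj_on[OF assms(2)], of v 0] by simp

lemma multiplicity_free_imp_abelian:
  assumes mf: "multiplicity_free G \<I>"
  shows "comm_group (K Mod N)"
  unfolding abelian_quotient_iff
proof (intro ballI)
  fix x y assume "x \<in> I" "y \<in> I"
  then obtain S T where x: "x \<in> carrier G" and S: "tw x S" "bij_betw S W W"
    and y: "y \<in> carrier G" and T: "tw y T" "bij_betw T W W" using mem_I by blast
  interpret ii: urep G \<I> by (rule urep_ind)
  obtain v where v: "v \<in> W" "v \<noteq> 0" using W_nonzero by blast
  \<comment> \<open>At this point one order of composition evaluates \<open>delta v\<close> at
    \<open>\<one>\<close>, the other at the element whose membership in \<open>N\<close> is
    wanted.\<close>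
  let ?g = "inv (x \<otimes> y)"
  have g: "?g \<in> carrier G" using x y by simp
  have "L x S (L y T (delta v)) = L y T (L x S (delta v))"
    by (rule ii.multiplicity_free_endo_commute[OF mf L_intertwiner[OF x S(1)] L_intertwiner[OF y T(1)]
        delta_in_H[OF v(1)]])
  then have "L x S (L y T (delta v)) ?g = L y T (L x S (delta v)) ?g" by simp
  then have "S (T (delta v (?g \<otimes> x \<otimes> y))) = T (S (delta v (?g \<otimes> y \<otimes> x)))"
    using x y by (simp add: L_def)
  moreover have "?g \<otimes> x \<otimes> y = \<one>" "?g \<otimes> y \<otimes> x = ?g \<otimes> (y \<otimes> x)" using x y by (simp_all add: m_assoc)
  moreover have "delta v \<one> = v" using v by (simp add: delta_def \<theta>_one)
  ultimately have e: "S (T v) = T (S (delta v (?g \<otimes> (y \<otimes> x))))" by simp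
  \<comment> \<open>The side evaluated at \<open>\<one>\<close> is nonzero by injectivity, so the
    other point must lie in the support \<open>N\<close> of \<open>delta v\<close>.\<close>
  have "S (T v) \<noteq> 0" using bij_tw_eq_0[OF T v(1)] bij_tw_eq_0[OF S tw_in[OF T(1) v(1)]] v(2) by blast
  then have "delta v (?g \<otimes> (y \<otimes> x)) \<noteq> 0" using e tw_zero[OF S(1)] tw_zero[OF T(1)] by metis
  then show "?g \<otimes> (y \<otimes> x) \<in> N" unfolding delta_def by meson
qed

text \<open>The map \<Phi> embeds \<xi> into the induced representation, projects to a summand
  \<open>U\<close> and evaluates at \<open>\<one>\<close>. It is injective because its kernel is
  invariant under the whole inertia group, and onto because \<theta> is irreducible.\<close>

lemma multiplicity_free_imp_restriction:
  assumes mf: "multiplicity_free G \<I>" and xi: "\<xi> \<in> I_hat G N \<theta>"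
  shows "equiv_rep GN (res_rep N \<xi>) \<theta>"
proof -
  interpret k: ind K N \<theta> by (rule ind_K)
  interpret ii: urep G \<I> by (rule urep_ind)
  have irr_xi: "irreducible_rep K \<xi>" and "contained_in K \<xi> (induced_rep K N \<theta>)"
    using xi unfolding I_hat_def I_def by auto
  then obtain X S where X: "invariant_subspace K (induced_rep K N \<theta>) X"
    and S: "intertwiner K \<xi> (subrep (induced_rep K N \<theta>) X) S" "bij_betw S (rep_space \<xi>) X"
    unfolding contained_in_def equiv_rep_iff_intertwiner by auto
  interpret x: urep K \<xi> by (rule irreducible_urep[OF group_K irr_xi])
  have XK: "X \<subseteq> k.H" using X unfolding invariant_subspace_def by blast
  have SK: "S v \<in> k.H" if "v \<in> rep_space \<xi>" for v using intertwinerD(1)[OF S(1) that] XK by auto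
  \<comment> \<open>Extension by zero from \<open>I\<close> to \<open>G\<close> costs nothing, as
    functions already vanish off the carrier. Covariance persists because \<open>I\<close> is a
    union of left cosets of \<open>N\<close>.\<close>
  have KH: "f \<in> H" if f: "f \<in> k.H" for f
  proof (rule HI)
    fix g assume g: "g \<in> carrier G"
    show "f g \<in> W" using k.H_in[OF f] k.H_out[OF f] W_zero by (cases "g \<in> I") auto
    fix h assume h: "h \<in> N"
    then have hI: "h \<in> I" using N_subset_I by blast
    show "f (g \<otimes> h) = \<theta>a (inv h) (f g)"
    proof (cases "g \<in> I")
      case True
      then show ?thesis using k.H_cov[OF f, of g h] h inv_K[OF hI] by simp
    next
      case False
      moreover have "g \<otimes> h \<notin> I"
      proof
        assume "g \<otimes> h \<in> I"
        then have "(g \<otimes> h) \<otimes> inv h \<in> I"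
          using hI subgroup.m_closed[OF subgroup_I] subgroup.m_inv_closed[OF subgroup_I] by blast
        then show False using False g h by (simp add: m_assoc)
      qed
      ultimately show ?thesis using k.H_out[OF f] \<theta>_zero[OF N_inv[OF h]] by simp
    qed
  qed (use k.H_out[OF f] I_in in auto)
  have SG: "intertwiner K \<xi> \<I> S"
  proof (rule intertwinerI)
    fix v assume v: "v \<in> rep_space \<xi>"
    show "S v \<in> H" by (rule KH[OF SK[OF v]])
    show "S (u + v) = S u + S v" if "u \<in> rep_space \<xi>" for u using intertwinerD(2)[OF S(1) that v] .
    show "S (rep_scale \<xi> c v) = rep_scale \<I> c (S v)" for c
      using intertwinerD(3)[OF S(1) v] by (simp add: fun_eq_iff)
    fix y assume yK: "y \<in> carrier K"
    then have y: "y \<in> I" by simp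
    have iy: "inv y \<in> I" by (rule subgroup.m_inv_closed[OF subgroup_I y])
    \<comment> \<open>Translation by an element of \<open>I\<close> preserves both \<open>I\<close>
      and its complement, so the actions induced over \<open>K\<close> and over \<open>G\<close>
      agree on these functions.\<close>
    have "rep_act (induced_rep K N \<theta>) y (S v) g = rep_act \<I> y (S v) g" for g
    proof (cases "g \<in> I")
      case True
      then show ?thesis using I_in inv_K[OF y] by (simp add: k.ind_act ind_act)
    next
      case False
      have "inv y \<otimes> g \<notin> I" if g: "g \<in> carrier G"
      proof
        assume "inv y \<otimes> g \<in> I"
        then have "y \<otimes> (inv y \<otimes> g) \<in> I" using y subgroup.m_closed[OF subgroup_I] by blast
        then show False using False g I_in[OF y] by (simp add: m_assoc[symmetric])
      qed
      then show ?thesis using False k.H_out[OF SK[OF v]] by (simp add: k.ind_act ind_act)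
    qed
    then show "S (rep_act \<xi> y v) = rep_act \<I> y (S v)"
      using intertwinerD(4)[OF S(1) yK v] by (simp add: fun_eq_iff)
  qed
  note Si = intertwinerD[OF SG]
  obtain v0 where v0: "v0 \<in> rep_space \<xi>" "v0 \<noteq> 0"
    using irr_xi x.subspace_0[OF x.subspace_V] unfolding irreducible_rep_def by blast
  have "S 0 = 0" using Si(3)[OF v0(1), of 0] by simp
  then have "S v0 \<noteq> 0"
    using v0 inj_onD[OF bij_betw_imp_inj_on[OF S(2)], of v0 0] x.subspace_0[OF x.subspace_V] by auto
  then obtain y where y: "S v0 y \<noteq> 0" by (auto simp: fun_eq_iff)
  have yI: "y \<in> I" using k.H_out[OF SK[OF v0(1)], of y] y by auto
  have iyI: "inv y \<in> I" by (rule subgroup.m_inv_closed[OF subgroup_I yI])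
  \<comment> \<open>Translating by \<open>inv y\<close> moves a point where \<open>S v0\<close> is
    nonzero to \<open>\<one>\<close>.\<close>
  define v1 where "v1 = rep_act \<xi> (inv y) v0"
  have v1: "v1 \<in> rep_space \<xi>" unfolding v1_def using x.act_in iyI v0 by simp
  have "S v1 \<one> = S v0 y"
    unfolding v1_def using Si(4)[of "inv y" v0] iyI v0 I_in[OF yI] by (simp add: ind_act)
  then have "(\<Sum>U\<in>ii.dec. ii.proj U (S v1)) \<one> \<noteq> 0" using ii.sum_proj_dec[OF Si(1)[OF v1]] y by simp
  then obtain U where U: "U \<in> ii.dec" and U1: "ii.proj U (S v1) \<one> \<noteq> 0"
    unfolding sum_fun_apply by (rule sum.not_neutral_contains_not_neutral)
  let ?Q = "ii.proj U"
  have Q: "intertwiner G \<I> \<I> ?Q"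
    by (rule ii.intertwiner_corestrict[OF ii.dec_invariant[OF U] ii.intertwiner_proj[OF ii.dec_invariant[OF U]]])
  note Qi = intertwinerD[OF Q]
  define \<Phi> where "\<Phi> v = ?Q (S v) \<one>" for v
  \<comment> \<open>On \<open>U\<close> the endomorphism \<open>L z T\<close> is a scalar
    \<open>c\<close>. Evaluated at \<open>\<one>\<close> this says that \<open>T\<close> applied to
    the value at \<open>z\<close> is \<open>c\<close> times the value at \<open>\<one>\<close>,
    which is 0; \<open>T\<close> is injective.\<close>
  have \<Phi>_zero_I: "?Q (S v) z = 0" if v: "v \<in> rep_space \<xi>" and 0: "\<Phi> v = 0" and z: "z \<in> I" for v z
  proof -
    obtain T where zG: "z \<in> carrier G" and T: "tw z T" "bij_betw T W W" using z mem_I by blast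
    have QU: "?Q (S v) \<in> U" by (rule ii.dec_proj_in[OF U Si(1)[OF v]])
    obtain c where "\<forall>u\<in>U. L z T u = rep_scale \<I> c u"
      using ii.multiplicity_free_endo_scalar[OF mf L_intertwiner[OF zG T(1)] U] by blast
    then have "L z T (?Q (S v)) \<one> = rep_scale \<I> c (?Q (S v)) \<one>" using QU by simp
    then have "T (?Q (S v) z) = 0" using zG 0 by (simp add: L_def \<Phi>_def)
    then show ?thesis using bij_tw_eq_0[OF T H_in[OF Qi(1)[OF Si(1)[OF v]] zG]] by blast
  qed
  \<comment> \<open>The action on \<xi> only moves the point of evaluation. Both the invariance of
    the kernel and the equivariance of \<Phi> under \<open>N\<close> come from this.\<close>
  have \<Phi>_act: "\<Phi> (rep_act \<xi> z v) = ?Q (S v) (inv z)" if z: "z \<in> I" and v: "v \<in> rep_space \<xi>" for z v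
    using Si(4)[of z v] Qi(4)[OF I_in[OF z] Si(1)[OF v]] z v I_in[OF z] by (simp add: \<Phi>_def ind_act)
  have \<Phi>_add: "\<Phi> (u + v) = \<Phi> u + \<Phi> v" if "u \<in> rep_space \<xi>" "v \<in> rep_space \<xi>" for u v
    using Si(2)[OF that] Qi(2)[OF Si(1) Si(1), OF that] by (simp add: \<Phi>_def)
  have \<Phi>_scale: "\<Phi> (rep_scale \<xi> c v) = \<theta>s c (\<Phi> v)" if "v \<in> rep_space \<xi>" for c v
    using Si(3)[OF that] Qi(3)[OF Si(1)[OF that]] by (simp add: \<Phi>_def)
  have \<Phi>_0: "\<Phi> 0 = 0" using \<Phi>_scale[of 0 0] x.subspace_0[OF x.subspace_V] by simp
  \<comment> \<open>By \<open>\<Phi>_zero_I\<close>, vanishing at \<open>\<one>\<close> forces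
    vanishing on all of \<open>I\<close>, so \<open>Z\<close> is invariant under \<open>K\<close>;
    it misses \<open>v1\<close> and is therefore zero.\<close>
  define Z where "Z = {v \<in> rep_space \<xi>. \<Phi> v = 0}"
  have "x.subspace Z"
    unfolding Z_def
    by (intro x.subspaceI) (auto simp: \<Phi>_0 \<Phi>_add \<Phi>_scale x.subspace_0 x.subspace_add x.subspace_scale x.subspace_V)
  moreover have "rep_act \<xi> z v \<in> Z" if z: "z \<in> I" and v: "v \<in> Z" for z v
    using v \<Phi>_act[OF z, of v] \<Phi>_zero_I[of v "inv z"] subgroup.m_inv_closed[OF subgroup_I z] x.act_in z
    unfolding Z_def by simp
  ultimately have "invariant_subspace K \<xi> Z" unfolding invariant_subspace_def by (auto simp: Z_def)
  moreover have "v1 \<notin> Z" using U1 by (simp add: Z_def \<Phi>_def)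
  ultimately have Z: "Z = {0}" using irr_xi v1 unfolding irreducible_rep_def by blast
  have NK: "N \<subseteq> I" by (rule N_subset_I)
  have uni_res: "unitary_rep GN (res_rep N \<xi>)"
    by (rule group.unitary_rep_pullback[OF group_GN x.unitary group_K, where \<phi> = "\<lambda>n. n"]) (use NK in auto)
  have u: "urep GN (res_rep N \<xi>)" using group_GN uni_res by (simp add: urep_def urep_axioms_def)
  have \<Phi>: "intertwiner GN (res_rep N \<xi>) \<theta> \<Phi>"
  proof (rule intertwinerI)
    fix v assume "v \<in> rep_space (res_rep N \<xi>)"
    then have v: "v \<in> rep_space \<xi>" by simp
    show "\<Phi> v \<in> W" unfolding \<Phi>_def by (rule H_in[OF Qi(1)[OF Si(1)[OF v]]]) simp
    fix n assume "n \<in> carrier GN"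
    then have n: "n \<in> N" by simp
    have "\<Phi> (rep_act \<xi> n v) = ?Q (S v) (\<one> \<otimes> inv n)" using \<Phi>_act n v NK by auto
    also have "\<dots> = \<theta>a n (\<Phi> v)"
      using H_cov[OF Qi(1)[OF Si(1)[OF v]], of \<one> "inv n"] n by (simp add: \<Phi>_def)
    finally show "\<Phi> (rep_act (res_rep N \<xi>) n v) = \<theta>a n (\<Phi> v)" using n by simp
  qed (simp_all add: \<Phi>_add \<Phi>_scale)
  have "inj_on \<Phi> (rep_space (res_rep N \<xi>))"
    by (rule intertwiner_inj_on[OF u urep_\<theta> \<Phi>]) (use Z in \<open>auto simp: Z_def\<close>)
  moreover have "\<Phi> ` rep_space \<xi> = {0} \<or> \<Phi> ` rep_space \<xi> = W"
    using invariant_image[OF u urep_\<theta> \<Phi>] irr unfolding irreducible_rep_def by simp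
  moreover have "\<Phi> ` rep_space \<xi> \<noteq> {0}" using U1 v1 unfolding \<Phi>_def by blast
  ultimately have "bij_betw \<Phi> (rep_space \<xi>) W" unfolding bij_betw_def by simp
  then show ?thesis using \<Phi> unfolding equiv_rep_iff_intertwiner by auto
qed

section \<open>Sufficiency of the two conditions\<close>

text \<open>Ensures that condition (ii) is not vacuous and really provides an extension of \<theta>.
  The induced space over \<open>K\<close> contains a nonzero \<open>delta v\<close>, hence an
  irreducible subspace.\<close>

lemma I_hat_nonempty: "\<exists>\<xi>. \<xi> \<in> I_hat G N \<theta>"
proof -
  interpret k: ind K N \<theta> by (rule ind_K)
  interpret kk: urep K "induced_rep K N \<theta>" by (rule k.urep_ind)
  obtain v where v: "v \<in> W" "v \<noteq> 0" using W_nonzero by blast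
  have "k.delta v \<one> = v" using v k.\<theta>_one k.N_one by (simp add: k.delta_def inv_K subgroup.one_closed[OF subgroup_I])
  then have "k.delta v \<noteq> 0" using v by (metis zero_fun_apply)
  then have "k.H \<noteq> {0}" using k.delta_in_H v by blast
  then obtain X where X: "invariant_subspace K (induced_rep K N \<theta>) X"
    "irreducible_rep K (subrep (induced_rep K N \<theta>) X)"
    using kk.irreducible_subspace_exists[OF kk.invariant_V] by blast
  then obtain \<xi> :: "'a std_rep" where "irreducible_rep K \<xi>" "equiv_rep K \<xi> (subrep (induced_rep K N \<theta>) X)"
    using irreducible_std_copy_exists[OF group_K X(2)] by blast
  then show ?thesis using X(1) unfolding I_hat_def contained_in_def I_def by blast
qed

text \<open>Conditions (i) and (ii) yield an extension of \<open>\<theta>\<close> to the inertia group, so that the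
  convolution algebra becomes the group algebra of an Abelian group.\<close>

lemma extension_imp_multiplicity_free:
  assumes ab: "comm_group (K Mod N)" and xi: "\<xi> \<in> I_hat G N \<theta>"
    and ext: "equiv_rep GN (res_rep N \<xi>) \<theta>"
  shows "multiplicity_free G \<I>"
proof -
  interpret ii: urep G \<I> by (rule urep_ind)
  have irr_xi: "irreducible_rep K \<xi>" using xi unfolding I_hat_def I_def by auto
  interpret x: urep K \<xi> by (rule irreducible_urep[OF group_K irr_xi])
  have NK: "n \<in> I" if "n \<in> N" for n using N_subset_I that by blast
  obtain S where S: "intertwiner GN (res_rep N \<xi>) \<theta> S" "bij_betw S (rep_space \<xi>) W"
    using ext unfolding equiv_rep_iff_intertwiner by auto
  define R where "R = the_inv_into (rep_space \<xi>) S"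
  have inj: "inj_on S (rep_space \<xi>)" and im: "S ` rep_space \<xi> = W" using S(2) unfolding bij_betw_def by blast+
  have S_in: "S v \<in> W" if "v \<in> rep_space \<xi>" for v using that im by blast
  have S_add: "S (u + v) = S u + S v" if "u \<in> rep_space \<xi>" "v \<in> rep_space \<xi>" for u v
    using intertwinerD(2)[OF S(1)] that by simp
  have S_scale: "S (rep_scale \<xi> c v) = \<theta>s c (S v)" if "v \<in> rep_space \<xi>" for c v
    using intertwinerD(3)[OF S(1)] that by simp
  have S_act: "S (rep_act \<xi> n v) = \<theta>a n (S v)" if "n \<in> N" "v \<in> rep_space \<xi>" for n v
    using intertwinerD(4)[OF S(1)] that by simp
  have R_in: "R w \<in> rep_space \<xi>" and SR: "S (R w) = w" if "w \<in> W" for w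
    using that inj im the_inv_into_into[OF inj, of w "rep_space \<xi>"] f_the_inv_into_f[OF inj] by (auto simp: R_def)
  have RS: "R (S v) = v" if "v \<in> rep_space \<xi>" for v using that inj by (simp add: R_def the_inv_into_f_f)
  have R_add: "R (u + v) = R u + R v" if "u \<in> W" "v \<in> W" for u v
    using that RS[of "R u + R v"] S_add R_in SR x.subspace_add[OF x.subspace_V] by simp
  have R_scale: "R (\<theta>s c v) = rep_scale \<xi> c (R v)" if "v \<in> W" for c v
    using that RS[of "rep_scale \<xi> c (R v)"] S_scale R_in SR x.subspace_scale[OF x.subspace_V] by simp
  \<comment> \<open>The action of \<xi> carried over to \<open>W\<close> by \<open>S\<close>: a
    representation of \<open>I\<close> on \<open>W\<close> that agrees with \<theta> on
    \<open>N\<close>.\<close>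
  define T where "T y v = S (rep_act \<xi> y (R v))" for y v
  have T_in: "T y v \<in> W" if "y \<in> I" "v \<in> W" for y v
    using that S_in R_in x.act_in by (simp add: T_def)
  have T_mult: "T (y \<otimes> z) v = T y (T z v)" if "y \<in> I" "z \<in> I" "v \<in> W" for y z v
    using that x.act_mult[of y z "R v"] R_in RS x.act_in by (simp add: T_def)
  have T_N: "T n v = \<theta>a n v" if "n \<in> N" "v \<in> W" for n v
    using that S_act R_in SR by (simp add: T_def)
  have T_tw: "tw y (T y)" if y: "y \<in> I" for y
  proof (rule twI)
    fix n v assume n: "n \<in> N" and v: "v \<in> W"
    let ?m = "inv y \<otimes> n \<otimes> y"
    have m: "?m \<in> N" by (rule conj_N[OF I_in[OF y] n])
    have "T y (\<theta>a ?m v) = T (y \<otimes> ?m) v" using T_mult[OF y NK[OF m] v] T_N[OF m v] by simp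
    also have "y \<otimes> ?m = n \<otimes> y" using I_in[OF y] n by (simp add: m_assoc[symmetric])
    finally show "T y (\<theta>a ?m v) = \<theta>a n (T y v)" using T_mult[OF NK[OF n] y v] T_N[OF n T_in[OF y v]] by simp
  qed (use y in \<open>simp_all add: T_in, simp_all add: T_def R_add R_scale R_in x.act_add x.act_scale
      x.act_in S_add S_scale\<close>)
  have T_bij: "bij_betw (T y) W W" if y: "y \<in> I" for y
  proof (rule bij_betwI[where g = "T (inv y)"])
    have iy: "inv y \<in> I" by (rule subgroup.m_inv_closed[OF subgroup_I y])
    show "T y \<in> W \<rightarrow> W" "T (inv y) \<in> W \<rightarrow> W" using T_in y iy by auto
    show "T (inv y) (T y v) = v" "T y (T (inv y) v) = v" if "v \<in> W" for v
      using T_mult[OF iy y that] T_mult[OF y iy that] T_N[OF N_one that] \<theta>_one[OF that] I_in[OF y] by simp_all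
  qed
  have L_endo: "intertwiner G \<I> \<I> (L y (T y))" if "y \<in> I" for y
    by (rule L_intertwiner[OF I_in[OF that] T_tw[OF that]])
  have L_comm: "L y (T y) (L z (T z) f) = L z (T z) (L y (T y) f)"
    if y: "y \<in> I" and z: "z \<in> I" and f: "f \<in> H" for y z f
  proof (rule H_eqI)
    show "L y (T y) (L z (T z) f) \<in> H" "L z (T z) (L y (T y) f) \<in> H"
      using intertwinerD(1)[OF L_endo] y z f by blast+
    fix g assume g: "g \<in> carrier G"
    note yz = I_in[OF y] I_in[OF z]
    \<comment> \<open>The two orders of translation differ by this element of \<open>N\<close>.
      Covariance of \<open>f\<close> contributes the action of its inverse, which is cancelled
      because \<open>T (z \<otimes> y)\<close> is \<open>T (y \<otimes> z)\<close> after the action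
      of \<open>?n\<close>.\<close>
    let ?n = "inv (y \<otimes> z) \<otimes> (z \<otimes> y)"
    have n: "?n \<in> N" using ab y z unfolding abelian_quotient_iff by blast
    have zy: "z \<otimes> y = (y \<otimes> z) \<otimes> ?n" using yz by (simp add: m_assoc[symmetric])
    have yzI: "y \<otimes> z \<in> I" using y z subgroup.m_closed[OF subgroup_I] by blast
    have fW: "f (g \<otimes> (y \<otimes> z)) \<in> W" "f (g \<otimes> (z \<otimes> y)) \<in> W" using H_in[OF f] g yz by simp_all
    have "f (g \<otimes> (z \<otimes> y)) = \<theta>a (inv ?n) (f (g \<otimes> (y \<otimes> z)))"
      using H_cov[OF f, of "g \<otimes> (y \<otimes> z)" ?n] g yz n zy by (simp add: m_assoc)
    then have "\<theta>a ?n (f (g \<otimes> (z \<otimes> y))) = f (g \<otimes> (y \<otimes> z))"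
      using \<theta>_inv[OF N_inv[OF n] fW(1)] n by simp
    moreover have "T (z \<otimes> y) (f (g \<otimes> (z \<otimes> y))) = T (y \<otimes> z) (\<theta>a ?n (f (g \<otimes> (z \<otimes> y))))"
      using T_mult[OF yzI NK[OF n] fW(2)] T_N[OF n fW(2)] zy by simp
    ultimately have "T y (T z (f (g \<otimes> (y \<otimes> z)))) = T z (T y (f (g \<otimes> (z \<otimes> y))))"
      using T_mult[OF y z fW(1)] T_mult[OF z y fW(2)] by simp
    then show "L y (T y) (L z (T z) f) g = L z (T z) (L y (T y) f) g"
      using g yz by (simp add: L_def m_assoc)
  qed
  have endo: "\<exists>c. \<forall>f\<in>H. E f = (\<Sum>y\<in>I. rep_scale \<I> (c y) (L y (T y) f))"
    if E: "intertwiner G \<I> \<I> E" for E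
  proof -
    \<comment> \<open>The kernel of \<open>E\<close> at \<open>y\<close> and \<open>T y\<close> both
      intertwine the \<open>y\<close>-conjugate of \<theta> with \<theta>, so Schur's lemma makes
      them proportional.\<close>
    have "\<exists>c. \<forall>v\<in>W. E (delta v) (inv y) = \<theta>s c (T y v)" if y: "y \<in> I" for y
      using schur_proportional[OF group_GN conj_irreducible[OF I_in[OF y]] irr T_tw[OF y] _
          endo_kernel_tw[OF E I_in[OF y]]] T_bij[OF y] by simp
    then obtain c where c: "\<And>y v. y \<in> I \<Longrightarrow> v \<in> W \<Longrightarrow> E (delta v) (inv y) = \<theta>s (c y) (T y v)" by metis
    \<comment> \<open>Outside \<open>I\<close> the conjugate is irreducible but not equivalent to
      \<theta>, so the kernel vanishes there.\<close>
    have z: "E (delta v) (inv y) = 0" if y: "y \<in> carrier G" "y \<notin> I" and v: "v \<in> W" for y v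
    proof -
      have "\<not> bij_betw (\<lambda>v. E (delta v) (inv y)) W W" using y endo_kernel_tw[OF E y(1)] mem_I by blast
      then show ?thesis
        using schur_zero_or_bij[OF group_GN conj_irreducible[OF y(1)] irr endo_kernel_tw[OF E y(1)]] v by simp
    qed
    let ?a = "1 / of_nat (card N) :: complex"
    have "E f = (\<Sum>y\<in>I. rep_scale \<I> (?a * c y) (L y (T y) f))" if f: "f \<in> H" for f
    proof (rule H_eqI)
      show "E f \<in> H" by (rule intertwinerD(1)[OF E f])
      show "(\<Sum>y\<in>I. rep_scale \<I> (?a * c y) (L y (T y) f)) \<in> H"
        by (intro i.subspace_sum[OF subspace_H] i.subspace_scale[OF subspace_H] intertwinerD(1)[OF L_endo f])
      fix g assume g: "g \<in> carrier G"
      have "(\<Sum>y\<in>carrier G. E (delta (f (g \<otimes> y))) (inv y)) = (\<Sum>y\<in>I. E (delta (f (g \<otimes> y))) (inv y))"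
        using z H_in[OF f] g by (intro sum.mono_neutral_right fin) (auto simp: I_in)
      also have "\<dots> = (\<Sum>y\<in>I. \<theta>s (c y) (T y (f (g \<otimes> y))))"
        using c H_in[OF f] g I_in by (intro sum.cong refl) simp
      finally show "E f g = (\<Sum>y\<in>I. rep_scale \<I> (?a * c y) (L y (T y) f)) g"
        using endo_convolution[OF E f g] g by (simp add: t.scale_sum_right sum_fun_apply L_def)
    qed
    then show ?thesis by (intro exI[of _ "\<lambda>y. ?a * c y"]) blast
  qed
  have lin: "A (\<Sum>y\<in>I. rep_scale \<I> (c y) (L y (T y) f)) = (\<Sum>y\<in>I. rep_scale \<I> (c y) (A (L y (T y) f)))"
    if A: "intertwiner G \<I> \<I> A" and f: "f \<in> H" for A c f
  proof -
    have LH: "L y (T y) f \<in> H" if "y \<in> I" for y by (rule intertwinerD(1)[OF L_endo[OF that] f])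
    have "A (\<Sum>y\<in>I. rep_scale \<I> (c y) (L y (T y) f)) = (\<Sum>y\<in>I. A (rep_scale \<I> (c y) (L y (T y) f)))"
      by (rule intertwiner_sum[OF urep_ind urep_ind A i.subspace_scale[OF subspace_H LH]])
    also have "\<dots> = (\<Sum>y\<in>I. rep_scale \<I> (c y) (A (L y (T y) f)))"
      by (intro sum.cong refl intertwinerD(3)[OF A LH])
    finally show ?thesis .
  qed
  show ?thesis
  proof (rule ii.multiplicity_free_if_endo_commute)
    fix E F f assume E: "intertwiner G \<I> \<I> E" and F: "intertwiner G \<I> \<I> F" and f: "f \<in> H"
    obtain c where c: "\<And>f. f \<in> H \<Longrightarrow> E f = (\<Sum>y\<in>I. rep_scale \<I> (c y) (L y (T y) f))" using endo[OF E] by blast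
    obtain d where d: "\<And>f. f \<in> H \<Longrightarrow> F f = (\<Sum>y\<in>I. rep_scale \<I> (d y) (L y (T y) f))" using endo[OF F] by blast
    \<comment> \<open>\<open>E\<close> is a combination of the operators \<open>L z (T z)\<close>,
      which commute with \<open>L y (T y)\<close>; since \<open>F\<close> is also such a
      combination, \<open>E\<close> then commutes with \<open>F\<close>.\<close>
    have EL: "E (L y (T y) f) = L y (T y) (E f)" if y: "y \<in> I" for y
    proof -
      have "E (L y (T y) f) = (\<Sum>z\<in>I. rep_scale \<I> (c z) (L z (T z) (L y (T y) f)))"
        by (rule c[OF intertwinerD(1)[OF L_endo[OF y] f]])
      also have "\<dots> = (\<Sum>z\<in>I. rep_scale \<I> (c z) (L y (T y) (L z (T z) f)))"
        by (intro sum.cong refl arg_cong[of _ _ "rep_scale \<I> _"] L_comm[OF _ y f])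
      also have "\<dots> = L y (T y) (E f)" by (simp only: c[OF f] lin[OF L_endo[OF y] f])
      finally show ?thesis .
    qed
    have "E (F f) = (\<Sum>y\<in>I. rep_scale \<I> (d y) (E (L y (T y) f)))" by (simp only: d[OF f] lin[OF E f])
    also have "\<dots> = (\<Sum>y\<in>I. rep_scale \<I> (d y) (L y (T y) (E f)))" by (intro sum.cong refl) (simp only: EL)
    also have "\<dots> = F (E f)" by (rule d[OF intertwinerD(1)[OF E f], symmetric])
    finally show "E (F f) = F (E f)" .
  qed
qed

end

theorem theorem5p15:
  fixes G :: "('g, 'b) monoid_scheme" and N :: "'g set"
    and \<theta> :: "('g, 'v::ab_group_add) rep"
  assumes "group G" and "finite (carrier G)" and "N \<lhd> G"
    and "irreducible_rep (G\<lparr>carrier := N\<rparr>) \<theta>"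
  shows "multiplicity_free G (induced_rep G N \<theta>) \<longleftrightarrow>
    comm_group (G\<lparr>carrier := inertia_group G N \<theta>\<rparr> Mod N) \<and>
    (\<forall>\<xi>\<in>I_hat G N \<theta>. equiv_rep (G\<lparr>carrier := N\<rparr>) (res_rep N \<xi>) \<theta>)"
proof -
  have "ind G N \<theta>"
    using assms by (simp add: ind_def ind_axioms_def normal_imp_subgroup irreducible_rep_def)
  then interpret irr_ind G N \<theta>
    using assms by (simp add: irr_ind_def irr_ind_axioms_def)
  \<comment> \<open>For the converse, \<open>I_hat_nonempty\<close> supplies the \<xi> to which
    condition (ii) is applied.\<close>
  show ?thesis
    using multiplicity_free_imp_abelian multiplicity_free_imp_restriction
      extension_imp_multiplicity_free I_hat_nonempty
    unfolding I_def by blast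
qed

end
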